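(* Let $E\subset\mathbb{R}$ be a measurable set of positive measure, and assume that the Lebesgue measure of $E$ is finite. Then: (1) The operator $\mathscr{F}_E^{\ast}\mathscr{F}_E$ is an integral operator: $$(\mathscr{F}_E^{\ast}\mathscr{F}_Ex)(t)=\int_E K_E(t,s)x(s)\,ds,$$ with the kernel $$K_E(t,s)=\int_E e^{i\xi(t-s)}\,d\xi,\qquad t,s\in E.$$ (2) The operator $\mathscr{F}_E^{\ast}\mathscr{F}_E$ is a trace class operator: $$\operatorname{trace}\mathscr{F}_E^{\ast}\mathscr{F}_E=(\operatorname{mes}E)^2.$$ The operator $\mathscr{F}_E$ belongs to the class $\mathfrak{S}_2$ of Hilbert–Schmidt operators: $$\Vert\mathscr{F}_E\Vert_{\mathfrak{S}_2}=\operatorname{mes}E.$$ In particular, the operator $\mathscr{F}_E$ is a compact operator. (3) The trace norm of the operator $\mathscr{F}_E$ satisfies the condition $$(\operatorname{mes}E)^2\le\Vert\mathscr{F}_E\Vert_{\mathfrak{S}_1}\le\infty.$$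
   Context: $\operatorname{mes}$ denotes Lebesgue measure on $\mathbb{R}$; $L^2(E)$ is the complex Hilbert space of square-integrable functions on $E$. The truncated Fourier operator $\mathscr{F}_E:L^2(E)\to L^2(E)$ is defined by $(\mathscr{F}_Ex)(t)=\frac{1}{\sqrt{2\pi}}\int_E e^{it\xi}x(\xi)\,d\xi$, $t\in E$, and its adjoint is $(\mathscr{F}_E^{\ast}x)(t)=\frac{1}{\sqrt{2\pi}}\int_E e^{-it\xi}x(\xi)\,d\xi$, $t\in E$. $\Vert\cdot\Vert_{\mathfrak{S}_2}$ is the Hilbert–Schmidt norm and $\Vert\cdot\Vert_{\mathfrak{S}_1}$ is the trace norm (the sum of the singular values, equal to $+\infty$ if the operator is not trace class).
   Formalization: With the factor 1/√(2π) in F_E the printed constants fail (E=[0,1] has trace 1/(2π)). Proved instead: kernel K_E(s,t)/(2π) in place of K_E(t,s), trace (mes E)²/(2π), Hilbert–Schmidt norm mes E/√(2π), and trace norm at least (mes E)²/(2π). *)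

theory Defs
  imports "HOL-Analysis.Analysis"
begin

section \<open>The complex Hilbert space of square-integrable functions\<close>

text \<open>
  Elements of the space are represented by square-integrable functions; two of them denote
  the same vector iff they agree almost everywhere, i.e. iff the seminorm of their
  difference is 0. Operators are maps on representatives, and identities between vectors are
  stated almost everywhere. For \<open>L\<^sup>2(E)\<close> take the measure \<^term>\<open>lebesgue_on E\<close>; values outside
  \<open>E\<close> are then irrelevant.
\<close>

definition L2 :: "'a measure \<Rightarrow> ('a \<Rightarrow> complex) set" where
  "L2 M = {f \<in> borel_measurable M. integrable M (\<lambda>x. (cmod (f x))\<^sup>2)}"

definition L2_inner :: "'a measure \<Rightarrow> ('a \<Rightarrow> complex) \<Rightarrow> ('a \<Rightarrow> complex) \<Rightarrow> complex" where
  "L2_inner M f g = (LINT x|M. f x * cnj (g x))"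

definition L2_norm :: "'a measure \<Rightarrow> ('a \<Rightarrow> complex) \<Rightarrow> real" where
  "L2_norm M f = sqrt (LINT x|M. (cmod (f x))\<^sup>2)"

definition L2_orthonormal :: "'a measure \<Rightarrow> ('a \<Rightarrow> complex) set \<Rightarrow> bool" where
  "L2_orthonormal M B \<longleftrightarrow>
     B \<subseteq> L2 M \<and> (\<forall>f\<in>B. \<forall>g\<in>B. L2_inner M f g = (if f = g then 1 else 0))"

definition L2_onb :: "'a measure \<Rightarrow> ('a \<Rightarrow> complex) set \<Rightarrow> bool" where
  "L2_onb M B \<longleftrightarrow> L2_orthonormal M B \<and>
     (\<forall>f\<in>L2 M. (\<forall>e\<in>B. L2_inner M f e = 0) \<longrightarrow> (AE x in M. f x = 0))"

text \<open>
  A fixed orthonormal basis (one exists, see below), used to write down traces and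
  Hilbert--Schmidt norms; as usual, these do not depend on the choice of the basis.
\<close>

definition L2_basis :: "'a measure \<Rightarrow> ('a \<Rightarrow> complex) set" where
  "L2_basis M = (SOME B. L2_onb M B)"


section \<open>Operators\<close>

type_synonym 'a L2_op = "('a \<Rightarrow> complex) \<Rightarrow> ('a \<Rightarrow> complex)"

text \<open>Everywhere defined bounded linear operators. Additivity, homogeneity and boundedness
  together imply that functions equal almost everywhere have images equal almost everywhere.\<close>

definition L2_operator :: "'a measure \<Rightarrow> 'a L2_op \<Rightarrow> bool" where
  "L2_operator M T \<longleftrightarrow>
     (\<forall>f\<in>L2 M. T f \<in> L2 M) \<and>
     (\<forall>f\<in>L2 M. \<forall>g\<in>L2 M. AE x in M. T (\<lambda>y. f y + g y) x = T f x + T g x) \<and>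
     (\<forall>c. \<forall>f\<in>L2 M. AE x in M. T (\<lambda>y. c * f y) x = c * T f x) \<and>
     (\<exists>C. \<forall>f\<in>L2 M. L2_norm M (T f) \<le> C * L2_norm M f)"

definition L2_is_adjoint :: "'a measure \<Rightarrow> 'a L2_op \<Rightarrow> 'a L2_op \<Rightarrow> bool" where
  "L2_is_adjoint M T S \<longleftrightarrow> (\<forall>g\<in>L2 M. S g \<in> L2 M) \<and>
     (\<forall>f\<in>L2 M. \<forall>g\<in>L2 M. L2_inner M (T f) g = L2_inner M f (S g))"

definition L2_adjoint :: "'a measure \<Rightarrow> 'a L2_op \<Rightarrow> 'a L2_op" where
  "L2_adjoint M T = (SOME S. L2_is_adjoint M T S)"

definition L2_compact :: "'a measure \<Rightarrow> 'a L2_op \<Rightarrow> bool" where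
  "L2_compact M T \<longleftrightarrow> L2_operator M T \<and>
     (\<forall>u :: nat \<Rightarrow> 'a \<Rightarrow> complex. (\<forall>n. u n \<in> L2 M) \<and> (\<exists>C. \<forall>n. L2_norm M (u n) \<le> C) \<longrightarrow>
        (\<exists>r. \<exists>g\<in>L2 M. strict_mono r \<and>
           (\<lambda>n. L2_norm M (\<lambda>x. T (u (r n)) x - g x)) \<longlonglongrightarrow> 0))"

definition L2_hilbert_schmidt :: "'a measure \<Rightarrow> 'a L2_op \<Rightarrow> bool" where
  "L2_hilbert_schmidt M T \<longleftrightarrow>
     L2_operator M T \<and> (\<lambda>e. (L2_norm M (T e))\<^sup>2) summable_on L2_basis M"

definition L2_hs_norm :: "'a measure \<Rightarrow> 'a L2_op \<Rightarrow> real" where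
  "L2_hs_norm M T = sqrt (\<Sum>\<^sub>\<infinity>e\<in>L2_basis M. (L2_norm M (T e))\<^sup>2)"

definition L2_eigenspace :: "'a measure \<Rightarrow> 'a L2_op \<Rightarrow> complex \<Rightarrow> ('a \<Rightarrow> complex) set" where
  "L2_eigenspace M A c = {f \<in> L2 M. AE x in M. A f x = c * f x}"

text \<open>Hilbert space dimension of a subspace: \<^term>\<open>\<infinity>\<close> if there are arbitrarily large finite
  orthonormal families in it.\<close>

definition L2_dim :: "'a measure \<Rightarrow> ('a \<Rightarrow> complex) set \<Rightarrow> ennreal" where
  "L2_dim M V = (SUP B\<in>{B. finite B \<and> B \<subseteq> V \<and> L2_orthonormal M B}. of_nat (card B))"

text \<open>
  The nonzero singular values of a compact operator \<open>T\<close> are the square roots \<open>s > 0\<close> of the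
  nonzero eigenvalues of \<open>T\<^sup>* T\<close>, each counted with the multiplicity of the eigenvalue \<open>s\<^sup>2\<close>.
  The integral over the counting measure is the sum over all \<open>s > 0\<close>; all numbers that are not
  singular values have multiplicity 0.
\<close>

definition L2_singular_mult :: "'a measure \<Rightarrow> 'a L2_op \<Rightarrow> real \<Rightarrow> ennreal" where
  "L2_singular_mult M T s =
     L2_dim M (L2_eigenspace M (\<lambda>f. L2_adjoint M T (T f)) (complex_of_real (s\<^sup>2)))"

definition L2_trace_norm :: "'a measure \<Rightarrow> 'a L2_op \<Rightarrow> ennreal" where
  "L2_trace_norm M T =
     (if L2_compact M T
      then (\<integral>\<^sup>+ s. ennreal s * L2_singular_mult M T s \<partial>count_space {0<..})
      else \<infinity>)"

definition L2_trace_class :: "'a measure \<Rightarrow> 'a L2_op \<Rightarrow> bool" where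
  "L2_trace_class M T \<longleftrightarrow> L2_compact M T \<and> L2_trace_norm M T < \<infinity>"

definition L2_trace :: "'a measure \<Rightarrow> 'a L2_op \<Rightarrow> complex" where
  "L2_trace M T = (\<Sum>\<^sub>\<infinity>e\<in>L2_basis M. L2_inner M (T e) e)"

definition L2_integral_operator ::
    "'a measure \<Rightarrow> 'a L2_op \<Rightarrow> ('a \<Rightarrow> 'a \<Rightarrow> complex) \<Rightarrow> bool" where
  "L2_integral_operator M T K \<longleftrightarrow>
     (\<forall>f\<in>L2 M. \<forall>t\<in>space M. integrable M (\<lambda>s. K t s * f s) \<and> T f t = (LINT s|M. K t s * f s))"


section \<open>The truncated Fourier operator\<close>

definition truncated_fourier :: "real set \<Rightarrow> real L2_op" where
  "truncated_fourier E x t =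
     1 / sqrt (2 * pi) * (LINT \<xi>|lebesgue_on E. exp (\<i> * t * \<xi>) * x \<xi>)"

definition truncated_fourier_adj :: "real set \<Rightarrow> real L2_op" where
  "truncated_fourier_adj E x t =
     1 / sqrt (2 * pi) * (LINT \<xi>|lebesgue_on E. exp (- (\<i> * t * \<xi>)) * x \<xi>)"

text \<open>
  Because of the factor \<open>1 / sqrt (2 * pi)\<close> and of the sign in the exponent of the adjoint, the
  kernel of \<open>F\<^sup>* F\<close> at \<open>(t, s)\<close> is \<open>fourier_kernel E s t / (2 * pi)\<close>.
\<close>

definition fourier_kernel :: "real set \<Rightarrow> real \<Rightarrow> real \<Rightarrow> complex" where
  "fourier_kernel E t s = (LINT \<xi>|lebesgue_on E. exp (\<i> * \<xi> * (t - s)))"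


section \<open>Well-definedness of the notions above\<close>

lemma L2_onb_exists: "\<exists>B. L2_onb M B"
proof -
  have "\<exists>B\<in>{B. L2_orthonormal M B}. \<forall>X\<in>{B. L2_orthonormal M B}. B \<subseteq> X \<longrightarrow> X = B"
  proof (rule subset_Zorn')
    fix C assume "subset.chain {B. L2_orthonormal M B} C"
    then have C: "\<And>B. B \<in> C \<Longrightarrow> L2_orthonormal M B"
      "\<And>A B. A \<in> C \<Longrightarrow> B \<in> C \<Longrightarrow> A \<subseteq> B \<or> B \<subseteq> A"
      by (auto simp: subset_chain_def)
    have "L2_inner M f g = (if f = g then 1 else 0)"
      if fg: "f \<in> A" "A \<in> C" "g \<in> B" "B \<in> C" for f g A B
    proof -
      obtain D where "D \<in> C" "f \<in> D" "g \<in> D" using C(2)[OF fg(2,4)] fg by blast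
      then show ?thesis using C(1)[of D] by (auto simp: L2_orthonormal_def)
    qed
    then have "\<forall>f\<in>\<Union>C. \<forall>g\<in>\<Union>C. L2_inner M f g = (if f = g then 1 else 0)"
      by (intro ballI) (elim UnionE)
    moreover have "\<Union>C \<subseteq> L2 M"
      using C(1) by (intro Union_least) (simp add: L2_orthonormal_def)
    ultimately show "\<Union>C \<in> {B. L2_orthonormal M B}"
      by (simp only: L2_orthonormal_def mem_Collect_eq simp_thms)
  qed
  then obtain B where B: "L2_orthonormal M B"
    and max: "\<And>X. L2_orthonormal M X \<Longrightarrow> B \<subseteq> X \<Longrightarrow> X = B" by auto
  have "AE x in M. f x = 0" if f: "f \<in> L2 M" and orth: "\<forall>e\<in>B. L2_inner M f e = 0" for f
  proof (rule ccontr)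
    assume nz: "\<not> (AE x in M. f x = 0)"
    define c where "c = (LINT x|M. (cmod (f x))\<^sup>2)"
    have meas: "f \<in> borel_measurable M" and int: "integrable M (\<lambda>x. (cmod (f x))\<^sup>2)"
      using f by (auto simp: L2_def)
    have "c \<noteq> 0"
      using integral_nonneg_eq_0_iff_AE[OF int] nz by (simp add: c_def)
    moreover have "c \<ge> 0" by (simp add: c_def)
    ultimately have c: "c > 0" by simp
    define g where "g = (\<lambda>x. f x / complex_of_real (sqrt c))"
    have inner_f: "L2_inner M f e = complex_of_real (sqrt c) * L2_inner M g e" for e
      using c by (simp add: L2_inner_def g_def)
    have g_L2: "g \<in> L2 M"
      using meas int by (simp add: L2_def g_def norm_divide power_divide)
    have gg: "L2_inner M g g = 1"
    proof -
      have "g x * cnj (g x) = complex_of_real ((cmod (f x))\<^sup>2 / c)" for x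
        using c by (simp only: complex_norm_square[symmetric])
          (simp add: g_def norm_divide power_divide)
      then have "L2_inner M g g = complex_of_real (LINT x|M. (cmod (f x))\<^sup>2 / c)"
        unfolding L2_inner_def by (simp only: integral_complex_of_real)
      then show ?thesis using c by (simp add: c_def)
    qed
    have ge: "L2_inner M g e = 0" if "e \<in> B" for e
      using inner_f[of e] orth that c by simp
    have eg: "L2_inner M e g = 0" if "e \<in> B" for e
    proof -
      have "L2_inner M e g = cnj (L2_inner M g e)"
        unfolding L2_inner_def by (subst Bochner_Integration.integral_cnj[symmetric])
          (simp add: mult.commute)
      then show ?thesis using ge[OF that] by simp
    qed
    have "g \<notin> B" using ge gg by force
    moreover have "L2_orthonormal M (insert g B)"
      using B g_L2 gg ge eg \<open>g \<notin> B\<close> by (auto simp: L2_orthonormal_def)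
    ultimately show False using max[of "insert g B"] by auto
  qed
  then show ?thesis using B by (auto simp: L2_onb_def)
qed

lemma L2_integrable:
  assumes "finite_measure M" "f \<in> L2 M"
  shows "integrable M f"
proof -
  interpret finite_measure M by fact
  have bd: "cmod (f x) \<le> 1 + (cmod (f x))\<^sup>2" for x
  proof -
    have "2 * cmod (f x) \<le> 1 + (cmod (f x))\<^sup>2"
      using sum_squares_bound[of 1 "cmod (f x)"] unfolding one_power2 mult_1_right .
    then show ?thesis using norm_ge_zero[of "f x"] by linarith
  qed
  have "norm (f x) \<le> norm (1 + (cmod (f x))\<^sup>2)" for x
    unfolding real_norm_def using bd[of x] by (rule order_trans) (rule abs_ge_self)
  moreover have "integrable M (\<lambda>x. 1 + (cmod (f x))\<^sup>2)" "f \<in> borel_measurable M"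
    using assms(2) by (simp_all add: L2_def)
  ultimately show ?thesis
    by (intro Bochner_Integration.integrable_bound[of M "\<lambda>x. 1 + (cmod (f x))\<^sup>2" f] AE_I2)
qed

lemma truncated_fourier_adjoint:
  assumes "E \<in> sets lebesgue" "emeasure lebesgue E < \<infinity>"
  shows "L2_is_adjoint (lebesgue_on E) (truncated_fourier E) (truncated_fourier_adj E)"
proof -
  define M where "M = lebesgue_on E"
  have fin: "finite_measure M"
    using assms by (auto simp: M_def intro!: finite_measureI simp: emeasure_restrict_space)
  then interpret finite_measure M .
  interpret pair_sigma_finite M M by unfold_locales
  have "(\<lambda>x. x) \<in> borel_measurable M"
    unfolding M_def by (simp add: measurable_restrict_space1 measurable_completion)
  then have of_real_meas [measurable]: "complex_of_real \<in> borel_measurable M"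
    using borel_measurable_of_real by auto
  have S_L2: "truncated_fourier_adj E g \<in> L2 M" if g: "g \<in> L2 M" for g
  proof -
    have gi: "integrable M g" by (rule L2_integrable[OF fin g])
    have [measurable]: "g \<in> borel_measurable M" using g by (simp add: L2_def)
    have [measurable]: "truncated_fourier_adj E g \<in> borel_measurable M"
      unfolding truncated_fourier_adj_def M_def[symmetric] by measurable
    have bd: "cmod (truncated_fourier_adj E g t) \<le> 1 / sqrt (2 * pi) * (LINT \<xi>|M. cmod (g \<xi>))" for t
    proof -
      have "cmod (LINT \<xi>|M. exp (- (\<i> * t * \<xi>)) * g \<xi>) \<le> (LINT \<xi>|M. cmod (exp (- (\<i> * t * \<xi>)) * g \<xi>))"
        by (rule integral_norm_bound)
      also have "\<dots> = (LINT \<xi>|M. cmod (g \<xi>))"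
        by (simp add: norm_mult)
      finally show ?thesis
        unfolding truncated_fourier_adj_def M_def[symmetric] norm_mult
        by (intro mult_mono) (auto simp: norm_divide)
    qed
    have bd2: "(cmod (truncated_fourier_adj E g t))\<^sup>2
        \<le> (1 / sqrt (2 * pi) * (LINT \<xi>|M. cmod (g \<xi>)))\<^sup>2" for t
      by (intro power_mono bd) simp
    have "integrable M (\<lambda>t. (cmod (truncated_fourier_adj E g t))\<^sup>2)"
    proof (rule integrable_const_bound)
      show "AE t in M. norm ((cmod (truncated_fourier_adj E g t))\<^sup>2)
          \<le> (1 / sqrt (2 * pi) * (LINT \<xi>|M. cmod (g \<xi>)))\<^sup>2"
        using bd2 by (intro AE_I2) (simp only: real_norm_def abs_power2)
    qed measurable
    then show ?thesis by (simp add: L2_def)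
  qed
  have inner: "L2_inner M (truncated_fourier E f) g = L2_inner M f (truncated_fourier_adj E g)"
    if f: "f \<in> L2 M" and g: "g \<in> L2 M" for f g
  proof -
    have fi: "integrable M f" and gi: "integrable M g" by (auto intro: L2_integrable fin f g)
    have meas: "f \<in> borel_measurable M" "g \<in> borel_measurable M"
      using f g by (auto simp: L2_def)
    let ?h = "\<lambda>(t, \<xi>). exp (\<i> * complex_of_real t * complex_of_real \<xi>) * f \<xi> * cnj (g t)"
    have cnj_meas: "cnj \<in> borel_measurable borel"
      by (intro borel_measurable_continuous_onI continuous_intros)
    have h_meas: "?h \<in> borel_measurable (M \<Otimes>\<^sub>M M)"
      unfolding case_prod_beta
      by (intro borel_measurable_times borel_measurable_const
          measurable_compose[OF _ borel_measurable_exp] measurable_compose[OF _ cnj_meas]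
          measurable_compose[OF measurable_fst of_real_meas]
          measurable_compose[OF measurable_snd of_real_meas]
          measurable_compose[OF measurable_fst meas(2)] measurable_compose[OF measurable_snd meas(1)])
    have int: "integrable (M \<Otimes>\<^sub>M M) ?h"
    proof (rule Fubini_integrable)
      show "integrable M (\<lambda>t. LINT \<xi>|M. norm (?h (t, \<xi>)))"
        using gi by (simp add: norm_mult)
      show "AE t in M. integrable M (\<lambda>\<xi>. ?h (t, \<xi>))"
      proof (rule AE_I2)
        fix t
        have "integrable M (\<lambda>\<xi>. exp (\<i> * complex_of_real t * complex_of_real \<xi>) * f \<xi>)"
          using fi
        proof (rule Bochner_Integration.integrable_bound)
          show "(\<lambda>\<xi>. exp (\<i> * complex_of_real t * complex_of_real \<xi>) * f \<xi>) \<in> borel_measurable M"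
            using meas by measurable
        qed (simp add: norm_mult)
        then show "integrable M (\<lambda>\<xi>. ?h (t, \<xi>))" by simp
      qed
    qed (rule h_meas)
    have "L2_inner M (truncated_fourier E f) g =
        1 / sqrt (2 * pi) * (LINT t|M. LINT \<xi>|M. ?h (t, \<xi>))"
    proof -
      have "truncated_fourier E f t * cnj (g t) = 1 / sqrt (2 * pi) * (LINT \<xi>|M. ?h (t, \<xi>))" for t
        unfolding truncated_fourier_def M_def[symmetric] by simp
      then show ?thesis unfolding L2_inner_def by simp
    qed
    also have "(LINT t|M. LINT \<xi>|M. ?h (t, \<xi>)) = (LINT \<xi>|M. LINT t|M. ?h (t, \<xi>))"
      using Fubini_integral[of "\<lambda>t \<xi>. ?h (t, \<xi>)"] int by simp
    also have "1 / sqrt (2 * pi) * \<dots> = L2_inner M f (truncated_fourier_adj E g)"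
    proof -
      have "f \<xi> * cnj (truncated_fourier_adj E g \<xi>) =
          1 / sqrt (2 * pi) * (LINT t|M. ?h (t, \<xi>))" for \<xi>
      proof -
        have "cnj (truncated_fourier_adj E g \<xi>) = 
            1 / sqrt (2 * pi) * (LINT t|M. exp (\<i> * complex_of_real t * complex_of_real \<xi>) * cnj (g t))"
          unfolding truncated_fourier_adj_def M_def[symmetric]
          by (simp flip: Bochner_Integration.integral_cnj add: exp_cnj mult_ac)
        then show ?thesis
          by (simp flip: integral_mult_right_zero add: mult_ac)
      qed
      then show ?thesis unfolding L2_inner_def by simp
    qed
    finally show ?thesis .
  qed
  show ?thesis unfolding L2_is_adjoint_def using S_L2 inner by (simp add: M_def)
qed

end

theory Submission
  imports Defs "HOL-Probability.Probability" "HOL-Complex_Analysis.Great_Picard"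
begin

text \<open>
  Write \<open>F x t = \<langle>x, k\<^sub>t\<rangle>\<close> with \<open>k\<^sub>t \<xi> = exp (- \<i> t \<xi>) / sqrt (2 \<pi>)\<close>, so that
  \<open>\<parallel>k\<^sub>t\<parallel>\<^sup>2 = mes E / (2 \<pi>)\<close>. Bessel's inequality for \<open>k\<^sub>t\<close>, integrated over \<open>t\<close>, bounds
  \<open>\<Sum>\<parallel>F e\<parallel>\<^sup>2\<close> over orthonormal families by \<open>(mes E)\<^sup>2 / (2 \<pi>)\<close>, and Parseval's identity turns this
  into an equality for orthonormal bases. Bounded sequences have subsequences whose images under
  \<open>F\<close> converge at all rational points, hence everywhere by equicontinuity, hence in norm by
  dominated convergence; so \<open>F\<close> is compact.

  The singular values of \<open>F\<^sup>* F\<close> are the squares of those of \<open>F\<close>, hence its trace norm is bounded by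
  the sum above. For the trace norm of \<open>F\<close> itself, the singular vectors for positive singular
  values \<open>s\<close> exhaust the orthogonal complement of the kernel, so the numbers \<open>s\<^sup>2\<close> sum to
  \<open>(mes E)\<^sup>2 / (2 \<pi>)\<close>; and \<open>s\<^sup>2 \<le> s\<close> because \<open>F\<close> is a contraction, which is proved by inserting
  a Gaussian convergence factor and applying Schur's test.
\<close>

subsection \<open>The semi-inner product on square-integrable functions\<close>

text \<open>The constants contain 2 pi because all the k_t have squared norm mes E / (2 pi), and
  integrating that over E contributes one more factor mes E. The delicate point is the lower bound
  for the trace norm of F. Cauchy-Schwarz bounds the operator norm by mes E / sqrt (2 pi), which
  exceeds 1 for large E and then says nothing about s^2 \<le> s. A bound by 1 for every E is one
  half of Plancherel's theorem. A Gaussian of width \<sigma> serves as the convergence factor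
  because its Fourier transform is again a Gaussian, positive and of mass proportional to 1 /
  \<sigma>, so that \<sigma> cancels and can be sent to infinity. A second obstacle is that basis
  and adjoint are arbitrary choices in the definitions. Singular vectors do not lie in the chosen
  basis, so Parseval's identity is proved for every orthonormal basis, possibly uncountable, and
  another basis is built around the singular vectors. Vectors are functions, so norm zero only means
  zero almost everywhere, and that case is often split off.\<close>

lemma L2_measurable: "f \<in> L2 M \<Longrightarrow> f \<in> borel_measurable M"
  by (simp add: L2_def)

lemma L2_integrable_mult:
  assumes "f \<in> L2 M" "g \<in> L2 M"
  shows "integrable M (\<lambda>x. f x * cnj (g x))"
proof (rule Bochner_Integration.integrable_bound)
  show "integrable M (\<lambda>x. (cmod (f x))\<^sup>2 + (cmod (g x))\<^sup>2)"
    using assms by (simp add: L2_def)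
  have [measurable]: "f \<in> borel_measurable M" "g \<in> borel_measurable M"
    using assms by (auto simp: L2_def)
  have [measurable]: "cnj \<in> borel_measurable borel"
    by (intro borel_measurable_continuous_onI continuous_intros)
  show "(\<lambda>x. f x * cnj (g x)) \<in> borel_measurable M" by measurable
  have "cmod (f x) * cmod (g x) \<le> (cmod (f x))\<^sup>2 + (cmod (g x))\<^sup>2" for x
    using sum_squares_bound[of "cmod (f x)" "cmod (g x)"]
      mult_nonneg_nonneg[OF norm_ge_zero[of "f x"] norm_ge_zero[of "g x"]] by linarith
  then show "AE x in M. norm (f x * cnj (g x)) \<le> norm ((cmod (f x))\<^sup>2 + (cmod (g x))\<^sup>2)"
    by (auto simp: norm_mult intro!: AE_I2)
qed

lemma L2_zero: "(\<lambda>x. 0) \<in> L2 M"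
  by (simp add: L2_def)

lemma L2_scale: "f \<in> L2 M \<Longrightarrow> (\<lambda>x. c * f x) \<in> L2 M"
  by (auto simp: L2_def norm_mult power_mult_distrib intro: borel_measurable_times)

lemma L2_add:
  assumes "f \<in> L2 M" "g \<in> L2 M"
  shows "(\<lambda>x. f x + g x) \<in> L2 M"
proof -
  have [measurable]: "f \<in> borel_measurable M" "g \<in> borel_measurable M"
    using assms by (auto simp: L2_def)
  have bd: "(cmod (f x + g x))\<^sup>2 \<le> 2 * (cmod (f x))\<^sup>2 + 2 * (cmod (g x))\<^sup>2" for x
  proof -
    have "(cmod (f x + g x))\<^sup>2 \<le> (cmod (f x) + cmod (g x))\<^sup>2"
      by (intro power_mono norm_triangle_ineq) simp
    also have "\<dots> \<le> 2 * (cmod (f x))\<^sup>2 + 2 * (cmod (g x))\<^sup>2"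
      using sum_squares_bound[of "cmod (f x)" "cmod (g x)"] by (simp add: power2_sum)
    finally show ?thesis .
  qed
  have "integrable M (\<lambda>x. (cmod (f x + g x))\<^sup>2)"
  proof (rule Bochner_Integration.integrable_bound)
    show "integrable M (\<lambda>x. 2 * (cmod (f x))\<^sup>2 + 2 * (cmod (g x))\<^sup>2)"
      using assms by (simp add: L2_def)
  qed (use bd in \<open>auto intro!: AE_I2\<close>)
  then show ?thesis by (simp add: L2_def)
qed

lemma L2_diff: "f \<in> L2 M \<Longrightarrow> g \<in> L2 M \<Longrightarrow> (\<lambda>x. f x - g x) \<in> L2 M"
  using L2_add[of f M "\<lambda>x. (-1) * g x"] L2_scale[of g M "-1"] by simp

lemma L2_sum: "(\<And>i. i \<in> I \<Longrightarrow> f i \<in> L2 M) \<Longrightarrow> (\<lambda>x. \<Sum>i\<in>I. f i x) \<in> L2 M"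
  by (induction I rule: infinite_finite_induct) (auto intro: L2_zero L2_add)

lemma L2_inner_cnj: "L2_inner M g f = cnj (L2_inner M f g)"
  unfolding L2_inner_def by (subst Bochner_Integration.integral_cnj[symmetric])
    (simp add: mult.commute)

lemma L2_inner_scale_left: "L2_inner M (\<lambda>x. c * f x) g = c * L2_inner M f g"
  by (simp add: L2_inner_def mult.assoc)

lemma L2_inner_scale_right: "L2_inner M f (\<lambda>x. c * g x) = cnj c * L2_inner M f g"
proof -
  have "L2_inner M f (\<lambda>x. c * g x) = cnj (L2_inner M (\<lambda>x. c * g x) f)"
    by (rule L2_inner_cnj)
  then show ?thesis
    by (simp add: L2_inner_scale_left L2_inner_cnj[of M f g])
qed

lemma L2_inner_zero_left: "L2_inner M (\<lambda>x. 0) g = 0"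
  by (simp add: L2_inner_def)

lemma L2_inner_add_left:
  assumes "f \<in> L2 M" "g \<in> L2 M" "h \<in> L2 M"
  shows "L2_inner M (\<lambda>x. f x + g x) h = L2_inner M f h + L2_inner M g h"
  using assms by (simp add: L2_inner_def distrib_right L2_integrable_mult)

lemma L2_inner_diff_left:
  assumes "f \<in> L2 M" "g \<in> L2 M" "h \<in> L2 M"
  shows "L2_inner M (\<lambda>x. f x - g x) h = L2_inner M f h - L2_inner M g h"
  using assms by (simp add: L2_inner_def left_diff_distrib L2_integrable_mult)

lemma L2_inner_diff_right:
  assumes "f \<in> L2 M" "g \<in> L2 M" "h \<in> L2 M"
  shows "L2_inner M h (\<lambda>x. f x - g x) = L2_inner M h f - L2_inner M h g"
proof -
  have "L2_inner M h (\<lambda>x. f x - g x) = cnj (L2_inner M (\<lambda>x. f x - g x) h)"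
    by (rule L2_inner_cnj)
  then show ?thesis
    by (simp add: L2_inner_diff_left assms L2_inner_cnj[of M h f] L2_inner_cnj[of M h g])
qed

lemma L2_inner_sum_left:
  assumes "\<And>i. i \<in> I \<Longrightarrow> f i \<in> L2 M" "g \<in> L2 M"
  shows "L2_inner M (\<lambda>x. \<Sum>i\<in>I. f i x) g = (\<Sum>i\<in>I. L2_inner M (f i) g)"
  using assms(1)
proof (induction I rule: infinite_finite_induct)
  case (insert i I)
  then show ?case
    using assms(2) by (simp add: L2_inner_add_left L2_sum)
qed (simp_all add: L2_inner_zero_left)

lemma L2_inner_cong_AE:
  assumes "f \<in> L2 M" "f' \<in> L2 M" "g \<in> L2 M" "AE x in M. f x = f' x"
  shows "L2_inner M f g = L2_inner M f' g"
  unfolding L2_inner_def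
proof (rule integral_cong_AE)
  show "AE x in M. f x * cnj (g x) = f' x * cnj (g x)"
    using assms(4) by eventually_elim simp
qed (use assms in \<open>auto intro!: borel_measurable_integrable L2_integrable_mult\<close>)

lemma L2_norm_nonneg: "0 \<le> L2_norm M f"
  by (simp add: L2_norm_def)

lemma L2_norm_sq: "(L2_norm M f)\<^sup>2 = (LINT x|M. (cmod (f x))\<^sup>2)"
  by (simp add: L2_norm_def)

lemma L2_inner_self: "L2_inner M f f = complex_of_real ((L2_norm M f)\<^sup>2)"
  unfolding L2_inner_def L2_norm_sq
  by (simp only: integral_complex_of_real complex_norm_square[symmetric])

lemma L2_norm_scale: "L2_norm M (\<lambda>x. c * f x) = cmod c * L2_norm M f"
  by (simp add: L2_norm_def norm_mult power_mult_distrib real_sqrt_mult)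

lemma L2_norm_diff_sq:
  assumes "f \<in> L2 M" "g \<in> L2 M"
  shows "(L2_norm M (\<lambda>x. f x - g x))\<^sup>2
    = (L2_norm M f)\<^sup>2 - 2 * Re (L2_inner M f g) + (L2_norm M g)\<^sup>2"
proof -
  have "L2_inner M (\<lambda>x. f x - g x) (\<lambda>x. f x - g x)
    = L2_inner M f f - L2_inner M f g - cnj (L2_inner M f g) + L2_inner M g g"
    using assms L2_inner_cnj[of M g f]
    by (simp add: L2_inner_diff_left L2_inner_diff_right L2_diff)
  then have "Re (L2_inner M (\<lambda>x. f x - g x) (\<lambda>x. f x - g x))
    = Re (L2_inner M f f) - 2 * Re (L2_inner M f g) + Re (L2_inner M g g)"
    by simp
  then show ?thesis by (simp add: L2_inner_self)
qed

lemma L2_norm_diff_commute: "L2_norm M (\<lambda>x. f x - g x) = L2_norm M (\<lambda>x. g x - f x)"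
  by (simp add: L2_norm_def norm_minus_commute)

lemma L2_Cauchy_Schwarz:
  assumes "f \<in> L2 M" "g \<in> L2 M"
  shows "cmod (L2_inner M f g) \<le> L2_norm M f * L2_norm M g"
proof -
  define a where "a = (L2_norm M f)\<^sup>2"
  define b where "b = (L2_norm M g)\<^sup>2"
  define c where "c = L2_inner M f g"
  \<comment> \<open>Scaling \<open>g\<close> by \<open>t * c\<close> with \<open>t\<close> real
    makes the cross term real, which leaves a real quadratic in \<open>t\<close>.\<close>
  have quad: "0 \<le> a - 2 * t * (cmod c)\<^sup>2 + t\<^sup>2 * (cmod c)\<^sup>2 * b" for t :: real
  proof -
    have "0 \<le> (L2_norm M (\<lambda>x. f x - (t * c) * g x))\<^sup>2" by simp
    also have "\<dots> = a - 2 * Re (cnj (t * c) * c) + (cmod (t * c) * L2_norm M g)\<^sup>2"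
      using assms by (subst L2_norm_diff_sq)
        (simp_all add: L2_scale L2_inner_scale_right L2_norm_scale a_def c_def)
    also have "cnj (t * c) * c = complex_of_real (t * (cmod c)\<^sup>2)"
      by (simp only: of_real_mult complex_norm_square) simp
    also have "(cmod (t * c) * L2_norm M g)\<^sup>2 = t\<^sup>2 * (cmod c)\<^sup>2 * b"
      by (simp add: norm_mult power_mult_distrib b_def)
    finally show ?thesis by (simp add: mult.assoc)
  qed
  have "(cmod c)\<^sup>2 \<le> a * b"
  proof (cases "b = 0")
    case True
    have "(cmod c)\<^sup>2 = 0"
    proof (rule ccontr)
      assume "(cmod c)\<^sup>2 \<noteq> 0"
      then show False
        \<comment> \<open>For \<open>b = 0\<close> the quadratic is affine in \<open>t\<close>, and
          this \<open>t\<close> gives it the value -1.\<close>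
        using quad[of "(a + 1) / (2 * (cmod c)\<^sup>2)"] True by (simp add: field_simps)
    qed
    then show ?thesis using True by simp
  next
    case False
    then have b: "b > 0" by (simp add: b_def)
    show ?thesis using quad[of "1 / b"] b by (simp add: field_simps power2_eq_square)
  qed
  also have "\<dots> = (L2_norm M f * L2_norm M g)\<^sup>2"
    by (simp add: a_def b_def power_mult_distrib)
  finally show ?thesis
    unfolding c_def by (rule power2_le_imp_le) (simp add: L2_norm_nonneg)
qed

lemma L2_norm_diff_triangle:
  assumes "f \<in> L2 M" "g \<in> L2 M" "h \<in> L2 M"
  shows "L2_norm M (\<lambda>x. f x - h x) \<le> L2_norm M (\<lambda>x. f x - g x) + L2_norm M (\<lambda>x. g x - h x)"
proof (rule power2_le_imp_le)
  let ?p = "\<lambda>x. f x - g x" and ?q = "\<lambda>x. h x - g x"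
  have pq: "?p \<in> L2 M" "?q \<in> L2 M" using assms by (auto intro: L2_diff)
  have "(L2_norm M (\<lambda>x. f x - h x))\<^sup>2 = (L2_norm M (\<lambda>x. ?p x - ?q x))\<^sup>2" by simp
  also have "\<dots> = (L2_norm M ?p)\<^sup>2 - 2 * Re (L2_inner M ?p ?q) + (L2_norm M ?q)\<^sup>2"
    by (rule L2_norm_diff_sq[OF pq])
  also have "\<dots> \<le> (L2_norm M ?p)\<^sup>2 + 2 * (L2_norm M ?p * L2_norm M ?q) + (L2_norm M ?q)\<^sup>2"
    using L2_Cauchy_Schwarz[OF pq] abs_Re_le_cmod[of "L2_inner M ?p ?q"] by linarith
  also have "\<dots> = (L2_norm M ?p + L2_norm M (\<lambda>x. g x - h x))\<^sup>2"
    by (simp add: L2_norm_diff_commute[of M h g] power2_sum)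
  finally show "(L2_norm M (\<lambda>x. f x - h x))\<^sup>2
      \<le> (L2_norm M ?p + L2_norm M (\<lambda>x. g x - h x))\<^sup>2" .
qed (simp add: L2_norm_nonneg)

lemma L2_norm_eq_0_AE:
  assumes "f \<in> L2 M" "L2_norm M f = 0"
  shows "AE x in M. f x = 0"
  using assms integral_nonneg_eq_0_iff_AE[of M "\<lambda>x. (cmod (f x))\<^sup>2"]
  by (simp add: L2_def L2_norm_def)

lemma L2_norm_cong_AE:
  assumes "f \<in> L2 M" "g \<in> L2 M" "AE x in M. f x = g x"
  shows "L2_norm M f = L2_norm M g"
proof -
  have "AE x in M. g x = f x" using assms(3) by eventually_elim simp
  then have "L2_inner M f f = L2_inner M g g"
    using assms L2_inner_cong_AE[of f M g f] L2_inner_cong_AE[of f M g g]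
      L2_inner_cnj[of M f g] by (metis L2_inner_self complex_cnj_complex_of_real)
  then have "(L2_norm M f)\<^sup>2 = (L2_norm M g)\<^sup>2"
    by (simp only: L2_inner_self of_real_eq_iff)
  then show ?thesis by (simp add: L2_norm_nonneg)
qed

lemma L2_nn_integral_sq:
  assumes "f \<in> L2 M"
  shows "(\<integral>\<^sup>+ x. ennreal ((cmod (f x))\<^sup>2) \<partial>M) = ennreal ((L2_norm M f)\<^sup>2)"
  using assms by (simp add: L2_norm_sq L2_def nn_integral_eq_integral)

text \<open>Membership and the norm estimate both come from one bound on a nonnegative integral,
  which is the form in which Fatou's lemma delivers it.\<close>

lemma L2_I_nn_integral:
  assumes "f \<in> borel_measurable M" "(\<integral>\<^sup>+ x. ennreal ((cmod (f x))\<^sup>2) \<partial>M) \<le> ennreal c" "0 \<le> c"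
  shows "f \<in> L2 M" "(L2_norm M f)\<^sup>2 \<le> c"
proof -
  have [measurable]: "f \<in> borel_measurable M" by fact
  have "(\<integral>\<^sup>+ x. ennreal ((cmod (f x))\<^sup>2) \<partial>M) < \<infinity>"
    using assms(2) by (rule order.strict_trans1) simp
  then have "integrable M (\<lambda>x. (cmod (f x))\<^sup>2)"
    by (intro integrableI_nonneg) auto
  then show "f \<in> L2 M" using assms(1) by (simp add: L2_def)
  then show "(L2_norm M f)\<^sup>2 \<le> c"
    using assms(2,3) L2_nn_integral_sq by (metis ennreal_le_iff)
qed

section \<open>Convergence in norm and completeness\<close>

lemma L2_tendsto_inner:
  assumes "\<And>n. u n \<in> L2 M" "g \<in> L2 M" "h \<in> L2 M"
    and lim: "(\<lambda>n. L2_norm M (\<lambda>x. u n x - g x)) \<longlonglongrightarrow> 0"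
  shows "(\<lambda>n. L2_inner M (u n) h) \<longlonglongrightarrow> L2_inner M g h"
proof (rule Lim_transform[OF _ Lim_null_comparison])
  show "(\<lambda>n. L2_inner M g h) \<longlonglongrightarrow> L2_inner M g h" by simp
  show "(\<lambda>n. L2_norm M (\<lambda>x. u n x - g x) * L2_norm M h) \<longlonglongrightarrow> 0"
    using tendsto_mult_right[OF lim, of "L2_norm M h"] by simp
  show "\<forall>\<^sub>F n in sequentially. norm (L2_inner M (u n) h - L2_inner M g h)
      \<le> L2_norm M (\<lambda>x. u n x - g x) * L2_norm M h"
    using assms by (intro always_eventually allI)
      (auto simp: L2_inner_diff_left[symmetric] intro!: L2_Cauchy_Schwarz L2_diff)
qed

lemma L2_tendsto_norm:
  assumes "\<And>n. u n \<in> L2 M" "g \<in> L2 M"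
    and lim: "(\<lambda>n. L2_norm M (\<lambda>x. u n x - g x)) \<longlonglongrightarrow> 0"
  shows "(\<lambda>n. L2_norm M (u n)) \<longlonglongrightarrow> L2_norm M g"
proof (rule Lim_transform[OF _ Lim_null_comparison])
  show "(\<lambda>n. L2_norm M g) \<longlonglongrightarrow> L2_norm M g" by simp
  show "\<forall>\<^sub>F n in sequentially. norm (L2_norm M (u n) - L2_norm M g)
      \<le> L2_norm M (\<lambda>x. u n x - g x)"
  proof (intro always_eventually allI)
    fix n
    show "norm (L2_norm M (u n) - L2_norm M g) \<le> L2_norm M (\<lambda>x. u n x - g x)"
      using L2_norm_diff_triangle[OF assms(1)[of n] assms(2) L2_zero]
        L2_norm_diff_triangle[OF assms(2) assms(1)[of n] L2_zero]
        L2_norm_diff_commute[of M "u n" g] by simp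
  qed
qed (rule lim)

text \<open>Along a subsequence with increments \<open>d n\<close> of norm at most \<open>4\<^sup>-\<^sup>n\<close>, the function
  \<open>\<Sum>n. 4\<^sup>n \<bar>d n\<bar>\<^sup>2\<close> has a finite integral, so \<open>\<bar>d n\<bar> \<le> C 2\<^sup>-\<^sup>n\<close> almost everywhere; the
  pointwise limit is then the limit in norm by Fatou's lemma.\<close>

lemma L2_complete:
  assumes u: "\<And>n. u n \<in> L2 M"
    and Cauchy: "\<And>e. e > 0 \<Longrightarrow> \<exists>N. \<forall>m\<ge>N. \<forall>n\<ge>N. L2_norm M (\<lambda>x. u m x - u n x) < e"
  obtains g where "g \<in> L2 M" "(\<lambda>n. L2_norm M (\<lambda>x. u n x - g x)) \<longlonglongrightarrow> 0"
proof -
  have "\<exists>N. \<forall>m\<ge>N. \<forall>k\<ge>N. L2_norm M (\<lambda>x. u m x - u k x) < 1 / 4 ^ n" for n :: nat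
    by (rule Cauchy) simp
  then obtain N where N: "\<And>n m k. m \<ge> N n \<Longrightarrow> k \<ge> N n \<Longrightarrow> L2_norm M (\<lambda>x. u m x - u k x) < 1 / 4 ^ n"
    by metis
  \<comment> \<open>Summing puts \<open>r n\<close> beyond every \<open>N k\<close> with
    \<open>k \<le> n\<close>, so both terms of \<open>d n\<close> lie beyond
    \<open>N n\<close>.\<close>
  define r where "r n = (\<Sum>i\<le>n. N i)" for n
  have r_N: "k \<le> n \<Longrightarrow> N k \<le> r n" for k n
    unfolding r_def by (rule member_le_sum) auto
  define d where "d n x = u (r (Suc n)) x - u (r n) x" for n x
  have d_L2: "d n \<in> L2 M" for n
    unfolding d_def by (intro L2_diff u)
  have [measurable]: "u n \<in> borel_measurable M" "d n \<in> borel_measurable M" for n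
    by (auto intro: L2_measurable u d_L2)
  have d_norm: "L2_norm M (d n) \<le> 1 / 4 ^ n" for n
    unfolding d_def by (rule less_imp_le, rule N) (auto intro: r_N)
  have "(\<integral>\<^sup>+ x. (\<Sum>n. ennreal (4 ^ n * (cmod (d n x))\<^sup>2)) \<partial>M) = (\<Sum>n. \<integral>\<^sup>+ x. ennreal (4 ^ n * (cmod (d n x))\<^sup>2) \<partial>M)"
    by (rule nn_integral_suminf) measurable
  also have "\<dots> \<le> (\<Sum>n. ennreal ((1 / 4) ^ n))"
  proof (rule suminf_le)
    fix n
    have "(\<integral>\<^sup>+ x. ennreal (4 ^ n * (cmod (d n x))\<^sup>2) \<partial>M) = ennreal (4 ^ n) * ennreal ((L2_norm M (d n))\<^sup>2)"
      by (simp add: L2_nn_integral_sq[OF d_L2, symmetric] ennreal_mult nn_integral_cmult)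
    also have "\<dots> = ennreal (4 ^ n * (L2_norm M (d n))\<^sup>2)" by (simp add: ennreal_mult)
    also have "4 ^ n * (L2_norm M (d n))\<^sup>2 \<le> 4 ^ n * (1 / 4 ^ n)\<^sup>2"
      by (intro mult_left_mono power_mono d_norm) (auto simp: L2_norm_nonneg)
    also have "\<dots> = (1 / 4) ^ n" by (simp add: power2_eq_square power_one_over)
    finally show "(\<integral>\<^sup>+ x. ennreal (4 ^ n * (cmod (d n x))\<^sup>2) \<partial>M) \<le> ennreal ((1 / 4) ^ n)"
      by (simp add: ennreal_leI)
  qed auto
  also have "\<dots> = ennreal (\<Sum>n. (1 / 4) ^ n)"
    by (intro suminf_ennreal2) (auto simp: summable_geometric)
  also have "\<dots> < \<infinity>" by simp
  finally have "AE x in M. (\<Sum>n. ennreal (4 ^ n * (cmod (d n x))\<^sup>2)) \<noteq> \<infinity>"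
    by (intro nn_integral_PInf_AE) auto
  then have conv: "AE x in M. convergent (\<lambda>n. u (r n) x)"
  proof eventually_elim
    case (elim x)
    have term_le: "a n \<le> suminf a" for a :: "nat \<Rightarrow> ennreal" and n
      using sum_le_suminf[of a "{n}"] by simp
    have ennreal_E: "\<exists>K\<ge>0. a = ennreal K" if "a \<noteq> \<infinity>" for a
      using that by (cases a rule: ennreal_cases) auto
    obtain K where K: "0 \<le> K" "(\<Sum>n. ennreal (4 ^ n * (cmod (d n x))\<^sup>2)) = ennreal K"
      using ennreal_E[OF elim] by (elim exE conjE)
    have "cmod (d n x) \<le> sqrt K * (1 / 2) ^ n" for n
    proof (rule power2_le_imp_le)
      have "ennreal (4 ^ n * (cmod (d n x))\<^sup>2) \<le> ennreal K"
        unfolding K(2)[symmetric] by (rule term_le)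
      then have "4 ^ n * (cmod (d n x))\<^sup>2 \<le> K" using K(1) by simp
      then have "(cmod (d n x))\<^sup>2 \<le> K * (1 / 4) ^ n" by (simp add: field_simps power_one_over)
      also have "(1 / 4 :: real) ^ n = ((1 / 2) ^ n)\<^sup>2"
        by (simp add: power2_eq_square flip: power_mult_distrib)
      also have "K * ((1 / 2) ^ n)\<^sup>2 = (sqrt K * (1 / 2) ^ n)\<^sup>2"
        using K(1) by (simp only: power_mult_distrib real_sqrt_pow2)
      finally show "(cmod (d n x))\<^sup>2 \<le> (sqrt K * (1 / 2) ^ n)\<^sup>2" .
    qed (use K in simp)
    then have "summable (\<lambda>n. d n x)"
      by (rule summable_comparison_test'[where N = 0, rotated])
        (intro summable_mult summable_geometric, simp)
    then have "convergent (\<lambda>n. \<Sum>i<n. d i x)" by (simp add: summable_iff_convergent)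
    then have "convergent (\<lambda>n. (\<Sum>i<n. d i x) + u (r 0) x)"
      by (intro convergent_add convergent_const)
    moreover have "(\<Sum>i<n. d i x) + u (r 0) x = u (r n) x" for n
      unfolding d_def using sum_lessThan_telescope[of "\<lambda>k. u (r k) x" n] by simp
    ultimately show ?case by simp
  qed
  \<comment> \<open>Where the sequence diverges \<open>lim\<close> is an unspecified value;
    \<open>conv\<close> confines this to a null set.\<close>
  define g where "g x = lim (\<lambda>n. u (r n) x)" for x
  have [measurable]: "g \<in> borel_measurable M" unfolding g_def by measurable
  \<comment> \<open>Only \<open>k\<close> runs along the subsequence while \<open>m\<close> is any
    late index, so the estimate yields norm convergence of \<open>u\<close> itself.\<close>
  have Fatou: "(\<integral>\<^sup>+ x. ennreal ((cmod (u m x - g x))\<^sup>2) \<partial>M) \<le> ennreal ((1 / 4 ^ n)\<^sup>2)"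
    if "m \<ge> N n" for m n
  proof -
    have "(\<integral>\<^sup>+ x. ennreal ((cmod (u m x - g x))\<^sup>2) \<partial>M)
        = (\<integral>\<^sup>+ x. liminf (\<lambda>k. ennreal ((cmod (u m x - u (r k) x))\<^sup>2)) \<partial>M)"
    proof (rule nn_integral_cong_AE)
      show "AE x in M. ennreal ((cmod (u m x - g x))\<^sup>2)
          = liminf (\<lambda>k. ennreal ((cmod (u m x - u (r k) x))\<^sup>2))"
        using conv
      proof eventually_elim
        case (elim x)
        then have "(\<lambda>k. u (r k) x) \<longlonglongrightarrow> g x"
          unfolding g_def by (simp add: convergent_LIMSEQ_iff)
        then have "(\<lambda>k. ennreal ((cmod (u m x - u (r k) x))\<^sup>2)) \<longlonglongrightarrow> ennreal ((cmod (u m x - g x))\<^sup>2)"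
          by (intro tendsto_intros)
        then show ?case by (intro lim_imp_Liminf[symmetric]) auto
      qed
    qed
    also have "\<dots> \<le> liminf (\<lambda>k. \<integral>\<^sup>+ x. ennreal ((cmod (u m x - u (r k) x))\<^sup>2) \<partial>M)"
      by (rule nn_integral_liminf) measurable
    also have "\<dots> \<le> liminf (\<lambda>k::nat. ennreal ((1 / 4 ^ n)\<^sup>2))"
    proof (rule Liminf_mono, rule eventually_sequentiallyI[of n])
      fix k assume "n \<le> k"
      then have "L2_norm M (\<lambda>x. u m x - u (r k) x) \<le> 1 / 4 ^ n"
        using N[of n m "r k"] that r_N[of n k] by simp
      then have "(L2_norm M (\<lambda>x. u m x - u (r k) x))\<^sup>2 \<le> (1 / 4 ^ n)\<^sup>2"
        by (intro power_mono) (auto simp: L2_norm_nonneg)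
      then show "(\<integral>\<^sup>+ x. ennreal ((cmod (u m x - u (r k) x))\<^sup>2) \<partial>M) \<le> ennreal ((1 / 4 ^ n)\<^sup>2)"
        using L2_nn_integral_sq[OF L2_diff[OF u u], of m "r k"] by (simp add: ennreal_leI)
    qed
    also have "\<dots> = ennreal ((1 / 4 ^ n)\<^sup>2)"
      by (intro lim_imp_Liminf) auto
    finally show ?thesis .
  qed
  have diff: "(\<lambda>x. u m x - g x) \<in> L2 M" "L2_norm M (\<lambda>x. u m x - g x) \<le> 1 / 4 ^ n"
    if "m \<ge> N n" for m n
  proof -
    have "(\<lambda>x. u m x - g x) \<in> borel_measurable M" by measurable
    note * = L2_I_nn_integral[OF this Fatou[OF that]]
    show "(\<lambda>x. u m x - g x) \<in> L2 M" by (rule *) simp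
    have "(L2_norm M (\<lambda>x. u m x - g x))\<^sup>2 \<le> (1 / 4 ^ n)\<^sup>2" by (rule *) simp
    then show "L2_norm M (\<lambda>x. u m x - g x) \<le> 1 / 4 ^ n" by (rule power2_le_imp_le) simp
  qed
  \<comment> \<open>Fatou's lemma controls differences only, so \<open>g\<close> is recovered from
    \<open>u (N 0)\<close> and such a difference.\<close>
  have "(\<lambda>x. u (N 0) x - (u (N 0) x - g x)) \<in> L2 M"
    by (rule L2_diff[OF u diff(1)[of 0]]) simp
  moreover have "(\<lambda>x. u (N 0) x - (u (N 0) x - g x)) = g" by auto
  ultimately have "g \<in> L2 M" by simp
  moreover have "(\<lambda>n. L2_norm M (\<lambda>x. u n x - g x)) \<longlonglongrightarrow> 0"
  proof (rule LIMSEQ_I)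
    fix e :: real assume "e > 0"
    then obtain n where n: "(1 / 4) ^ n < e"
      using real_arch_pow_inv[of e "1 / 4"] by auto
    have "norm (L2_norm M (\<lambda>x. u m x - g x) - 0) < e" if "m \<ge> N n" for m
      using diff(2)[OF that] n L2_norm_nonneg[of M "\<lambda>x. u m x - g x"] by (simp add: power_one_over)
    then show "\<exists>N. \<forall>m\<ge>N. norm (L2_norm M (\<lambda>x. u m x - g x) - 0) < e" by blast
  qed
  ultimately show ?thesis by (rule that)
qed

subsection \<open>Orthonormal sets\<close>

lemma L2_orthonormalD:
  assumes "L2_orthonormal M B"
  shows "e \<in> B \<Longrightarrow> e \<in> L2 M"
    and "e \<in> B \<Longrightarrow> e' \<in> B \<Longrightarrow> L2_inner M e e' = (if e = e' then 1 else 0)"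
  using assms by (auto simp: L2_orthonormal_def)

lemma L2_orthonormal_norm:
  assumes "L2_orthonormal M B" "e \<in> B"
  shows "L2_norm M e = 1"
proof -
  have "complex_of_real ((L2_norm M e)\<^sup>2) = 1"
    using L2_orthonormalD(2)[OF assms(1,2,2)] by (simp add: L2_inner_self)
  then have "(L2_norm M e)\<^sup>2 = 1" by (simp only: of_real_eq_1_iff)
  then show ?thesis using L2_norm_nonneg[of M e] by (simp add: power2_eq_1_iff)
qed

lemma L2_orthonormal_subset: "L2_orthonormal M B \<Longrightarrow> A \<subseteq> B \<Longrightarrow> L2_orthonormal M A"
  unfolding L2_orthonormal_def by blast

lemma L2_orthonormal_insert:
  assumes "L2_orthonormal M B" "v \<in> L2 M" "L2_norm M v = 1"
    and "\<And>e. e \<in> B \<Longrightarrow> L2_inner M v e = 0"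
  shows "L2_orthonormal M (insert v B)" "v \<notin> B"
proof -
  have vv: "L2_inner M v v = 1" using assms(3) by (simp add: L2_inner_self)
  then show "v \<notin> B" using assms(4)[of v] by auto
  have "L2_inner M e v = 0" if "e \<in> B" for e
    using assms(4)[OF that] L2_inner_cnj[of M e v] by simp
  then show "L2_orthonormal M (insert v B)"
    using assms vv \<open>v \<notin> B\<close> by (auto simp: L2_orthonormal_def)
qed

text \<open>For a finite orthonormal \<open>G\<close> this is the orthogonal projection of
  \<open>f\<close> onto the span of \<open>G\<close>.\<close>

definition L2_partial :: "'a measure \<Rightarrow> ('a \<Rightarrow> complex) \<Rightarrow> ('a \<Rightarrow> complex) set \<Rightarrow> 'a \<Rightarrow> complex" where
  "L2_partial M f G x = (\<Sum>e\<in>G. L2_inner M f e * e x)"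

lemma L2_partial_L2: "G \<subseteq> L2 M \<Longrightarrow> L2_partial M f G \<in> L2 M"
  unfolding L2_partial_def[abs_def] by (intro L2_sum L2_scale) auto

lemma L2_inner_partial_left:
  assumes "G \<subseteq> L2 M" "g \<in> L2 M"
  shows "L2_inner M (L2_partial M f G) g = (\<Sum>e\<in>G. L2_inner M f e * L2_inner M e g)"
proof -
  have "L2_inner M (L2_partial M f G) g = (\<Sum>e\<in>G. L2_inner M (\<lambda>x. L2_inner M f e * e x) g)"
    unfolding L2_partial_def[abs_def] using assms by (intro L2_inner_sum_left L2_scale) auto
  then show ?thesis by (simp add: L2_inner_scale_left)
qed

lemma L2_inner_partial_member:
  assumes B: "L2_orthonormal M B" and G: "finite G" "G \<subseteq> B" "e \<in> B"
  shows "L2_inner M (L2_partial M f G) e = (if e \<in> G then L2_inner M f e else 0)"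
proof -
  have "L2_inner M (L2_partial M f G) e = (\<Sum>e'\<in>G. L2_inner M f e' * L2_inner M e' e)"
    using G L2_orthonormalD[OF B] by (intro L2_inner_partial_left) auto
  also have "\<dots> = (\<Sum>e'\<in>G. if e' = e then L2_inner M f e else 0)"
    using G L2_orthonormalD(2)[OF B] by (intro sum.cong) auto
  also have "\<dots> = (if e \<in> G then L2_inner M f e else 0)" using G by simp
  finally show ?thesis .
qed

text \<open>Pythagoras: the inner products of the projection with \<open>f\<close> and with itself
  both equal the sum of squared coefficients. Bessel's inequality and the final limit in Parseval's
  identity are both read off from this equation.\<close>

lemma L2_norm_sub_partial:
  assumes B: "L2_orthonormal M B" and G: "finite G" "G \<subseteq> B" and f: "f \<in> L2 M"
  shows "(L2_norm M (\<lambda>x. f x - L2_partial M f G x))\<^sup>2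
    = (L2_norm M f)\<^sup>2 - (\<Sum>e\<in>G. (cmod (L2_inner M f e))\<^sup>2)"
proof -
  let ?p = "L2_partial M f G"
  have GL: "G \<subseteq> L2 M" using B G by (auto simp: L2_orthonormal_def)
  then have p: "?p \<in> L2 M" by (rule L2_partial_L2)
  have "L2_inner M ?p f = (\<Sum>e\<in>G. L2_inner M f e * cnj (L2_inner M f e))"
    using L2_inner_partial_left[OF GL f, of f] L2_inner_cnj[of M _ f] by simp
  also have "\<dots> = complex_of_real (\<Sum>e\<in>G. (cmod (L2_inner M f e))\<^sup>2)"
    by (simp only: of_real_sum complex_norm_square)
  finally have pf: "L2_inner M ?p f = complex_of_real (\<Sum>e\<in>G. (cmod (L2_inner M f e))\<^sup>2)" .
  have "L2_inner M ?p ?p = (\<Sum>e\<in>G. L2_inner M f e * L2_inner M e ?p)"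
    by (rule L2_inner_partial_left[OF GL p])
  also have "\<dots> = (\<Sum>e\<in>G. L2_inner M f e * cnj (L2_inner M f e))"
  proof (rule sum.cong[OF refl])
    fix e assume "e \<in> G"
    then have "L2_inner M ?p e = L2_inner M f e"
      using L2_inner_partial_member[OF B G] G by auto
    then show "L2_inner M f e * L2_inner M e ?p = L2_inner M f e * cnj (L2_inner M f e)"
      using L2_inner_cnj[of M e ?p] by simp
  qed
  also have "\<dots> = complex_of_real (\<Sum>e\<in>G. (cmod (L2_inner M f e))\<^sup>2)"
    by (simp only: of_real_sum complex_norm_square)
  finally have "(L2_norm M ?p)\<^sup>2 = (\<Sum>e\<in>G. (cmod (L2_inner M f e))\<^sup>2)"
    unfolding L2_inner_self of_real_eq_iff .
  moreover have "Re (L2_inner M f ?p) = (\<Sum>e\<in>G. (cmod (L2_inner M f e))\<^sup>2)"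
    using pf L2_inner_cnj[of M f ?p] by simp
  ultimately show ?thesis by (simp add: L2_norm_diff_sq[OF f p])
qed

lemma L2_Bessel:
  assumes "L2_orthonormal M B" "finite G" "G \<subseteq> B" "f \<in> L2 M"
  shows "(\<Sum>e\<in>G. (cmod (L2_inner M f e))\<^sup>2) \<le> (L2_norm M f)\<^sup>2"
  using L2_norm_sub_partial[OF assms] zero_le_power2[of "L2_norm M (\<lambda>x. f x - L2_partial M f G x)"]
  by linarith

text \<open>Projections onto finite sets that nearly exhaust the coefficient sum form a Cauchy
  sequence. Its limit \<open>p\<close> has the same coefficients as \<open>f\<close>, so
  \<open>f - p\<close> is orthogonal to the basis and vanishes almost everywhere; hence no energy is
  lost in the limit.\<close>

lemma L2_Parseval:
  assumes B: "L2_onb M B" and f: "f \<in> L2 M"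
  shows "((\<lambda>e. (cmod (L2_inner M f e))\<^sup>2) has_sum (L2_norm M f)\<^sup>2) B"
proof -
  let ?c = "\<lambda>e. (cmod (L2_inner M f e))\<^sup>2"
  have on: "L2_orthonormal M B" using B by (simp add: L2_onb_def)
  note onD = L2_orthonormalD[OF on]
  have "?c summable_on B"
    using L2_Bessel[OF on _ _ f]
    by (intro nonneg_bdd_above_summable_on bdd_aboveI[of _ "(L2_norm M f)\<^sup>2"]) auto
  then obtain s where s: "(?c has_sum s) B" by (auto simp: summable_on_def)
  have le_s: "sum ?c G \<le> s" if "finite G" "G \<subseteq> B" for G
    using has_sum_mono_neutral[OF has_sum_finite[OF that(1)] s, of ?c] that by auto
  \<comment> \<open>These sets replace an enumeration of \<open>B\<close>, which may be uncountable.
    They come without nesting, so differences are compared inside the union \<open>H\<close> of two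
    of them.\<close>
  have "\<exists>G. finite G \<and> G \<subseteq> B \<and> s - 1 / real (Suc n) < sum ?c G" for n
  proof -
    have "\<forall>\<^sub>F G in finite_subsets_at_top B. s - 1 / real (Suc n) < sum ?c G"
      using s unfolding has_sum_def by (rule order_tendstoD) simp
    then show ?thesis by (auto simp: eventually_finite_subsets_at_top)
  qed
  then obtain G where G: "\<And>n. finite (G n)" "\<And>n. G n \<subseteq> B"
    "\<And>n. s - 1 / real (Suc n) < sum ?c (G n)" by metis
  define u where "u n = L2_partial M f (G n)" for n
  have u_L2: "u n \<in> L2 M" for n
    unfolding u_def using G onD by (intro L2_partial_L2) blast
  have u_norm: "(L2_norm M (\<lambda>x. u m x - u n x))\<^sup>2 \<le> 1 / real (Suc m) + 1 / real (Suc n)" for m n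
  proof -
    define H where "H = G m \<union> G n"
    have H: "finite H" "H \<subseteq> B" "G m \<subseteq> H" "G n \<subseteq> H" using G by (auto simp: H_def)
    have HL: "H \<subseteq> L2 M" using H onD by blast
    define w where "w x = u m x - u n x" for x
    have w: "w \<in> L2 M" unfolding w_def by (intro L2_diff u_L2)
    have inner_w: "L2_inner M w e = ((if e \<in> G m then 1 else 0) - (if e \<in> G n then 1 else 0)) * L2_inner M f e"
      if "e \<in> B" for e
      unfolding w_def using L2_inner_diff_left[OF u_L2 u_L2 onD(1)[OF that], of m n]
        L2_inner_partial_member[OF on G(1) G(2) that] by (simp add: u_def)
    \<comment> \<open>A combination of members of \<open>H\<close> is its own projection, so its
      norm is given by its coefficients alone.\<close>
    have w_eq: "w = L2_partial M w H"
    proof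
      fix x
      have "u m x = (\<Sum>e\<in>H. (if e \<in> G m then 1 else 0) * (L2_inner M f e * e x))"
        and "u n x = (\<Sum>e\<in>H. (if e \<in> G n then 1 else 0) * (L2_inner M f e * e x))"
        unfolding u_def L2_partial_def using H
        by (auto intro!: sum.mono_neutral_cong_left)
      then have "w x = (\<Sum>e\<in>H. ((if e \<in> G m then 1 else 0) - (if e \<in> G n then 1 else 0)) * L2_inner M f e * e x)"
        by (simp add: w_def sum_subtractf[symmetric] algebra_simps)
      then show "w x = L2_partial M w H x"
        unfolding L2_partial_def using H inner_w by (simp cong: sum.cong add: subset_iff)
    qed
    have "(L2_norm M (\<lambda>x. w x - L2_partial M w H x))\<^sup>2 = 0"
      by (subst w_eq[symmetric]) (simp add: L2_norm_def)
    then have "(L2_norm M w)\<^sup>2 = (\<Sum>e\<in>H. (cmod (L2_inner M w e))\<^sup>2)"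
      using L2_norm_sub_partial[OF on H(1,2) w] by simp
    \<comment> \<open>Only vectors in exactly one of the two sets have a nonzero coefficient in
      \<open>w\<close>; each bracket is the energy that one of the sets misses.\<close>
    also have "\<dots> \<le> (\<Sum>e\<in>H. (?c e - (if e \<in> G m then ?c e else 0)) + (?c e - (if e \<in> G n then ?c e else 0)))"
      using H(2) by (intro sum_mono) (auto simp: inner_w subset_iff norm_mult)
    also have "\<dots> = (sum ?c H - sum ?c (G m)) + (sum ?c H - sum ?c (G n))"
    proof -
      have "(\<Sum>e\<in>H. if e \<in> A then ?c e else 0) = sum ?c A" if "A \<subseteq> H" for A
        using that H(1) by (simp add: sum.inter_restrict[symmetric] Int_absorb1)
      then show ?thesis using H(3,4) by (simp only: sum.distrib sum_subtractf)
    qed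
    also have "\<dots> \<le> 1 / real (Suc m) + 1 / real (Suc n)"
      using le_s[OF H(1,2)] G(3)[of m] G(3)[of n] by linarith
    finally show ?thesis by (simp add: w_def[abs_def])
  qed
  have Cauchy: "\<exists>N. \<forall>m\<ge>N. \<forall>n\<ge>N. L2_norm M (\<lambda>x. u m x - u n x) < e" if "e > 0" for e
  proof -
    obtain N where N: "1 / real (Suc N) < e\<^sup>2 / 2"
      using reals_Archimedean[of "e\<^sup>2 / 2"] \<open>e > 0\<close> by (auto simp: inverse_eq_divide)
    have "L2_norm M (\<lambda>x. u m x - u n x) < e" if "m \<ge> N" "n \<ge> N" for m n
    proof -
      have "1 / real (Suc m) \<le> 1 / real (Suc N)" "1 / real (Suc n) \<le> 1 / real (Suc N)"
        using that by (auto intro!: divide_left_mono)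
      then have "(L2_norm M (\<lambda>x. u m x - u n x))\<^sup>2 < e\<^sup>2"
        using u_norm[of m n] N by linarith
      then show ?thesis using \<open>e > 0\<close> by (auto intro: power2_less_imp_less[OF _ less_imp_le])
    qed
    then show ?thesis by blast
  qed
  obtain p where p: "p \<in> L2 M" "(\<lambda>n. L2_norm M (\<lambda>x. u n x - p x)) \<longlonglongrightarrow> 0"
    by (rule L2_complete[of u M, OF u_L2 Cauchy])
  have "L2_inner M (\<lambda>x. f x - p x) e = 0" if e: "e \<in> B" for e
  proof -
    have eL: "e \<in> L2 M" by (rule onD(1)[OF e])
    have "(\<lambda>n. L2_inner M f e - L2_inner M (u n) e) \<longlonglongrightarrow> 0"
    proof (rule Lim_null_comparison)
      show "\<forall>\<^sub>F n in sequentially. norm (L2_inner M f e - L2_inner M (u n) e) \<le> sqrt (1 / real (Suc n))"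
      proof (intro always_eventually allI)
        fix n
        have "(cmod (L2_inner M f e - L2_inner M (u n) e))\<^sup>2 \<le> 1 / real (Suc n)"
        proof (cases "e \<in> G n")
          case True
          then show ?thesis
            by (simp add: u_def L2_inner_partial_member[OF on G(1) G(2) e])
        next
          case False
          \<comment> \<open>A missed coefficient is small: with \<open>e\<close> added the sum is
            still at most \<open>s\<close>, which \<open>G n\<close> alone nearly attains.\<close>
          then have "sum ?c (insert e (G n)) = ?c e + sum ?c (G n)" using G by simp
          then have "?c e \<le> 1 / real (Suc n)"
            using le_s[of "insert e (G n)"] G(1)[of n] G(2)[of n] G(3)[of n] e by auto
          then show ?thesis
            using False by (simp add: u_def L2_inner_partial_member[OF on G(1) G(2) e])
        qed
        then show "norm (L2_inner M f e - L2_inner M (u n) e) \<le> sqrt (1 / real (Suc n))"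
          by (rule real_le_rsqrt)
      qed
      show "(\<lambda>n. sqrt (1 / real (Suc n))) \<longlonglongrightarrow> 0"
        using tendsto_real_sqrt[OF LIMSEQ_Suc[OF lim_1_over_n]] by (simp add: inverse_eq_divide)
    qed
    moreover have "(\<lambda>n. L2_inner M f e - L2_inner M (u n) e) \<longlonglongrightarrow> L2_inner M f e - L2_inner M p e"
      by (intro tendsto_diff tendsto_const L2_tendsto_inner u_L2 p eL)
    ultimately have "L2_inner M f e - L2_inner M p e = 0"
      by (rule LIMSEQ_unique[THEN sym])
    then show ?thesis by (simp add: L2_inner_diff_left f p(1) eL)
  qed
  then have ae: "AE x in M. f x - p x = 0"
    using B L2_diff[OF f p(1)] unfolding L2_onb_def by blast
  have "L2_norm M f = L2_norm M p"
    using ae by (intro L2_norm_cong_AE f p) auto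
  have "(\<lambda>n. (L2_norm M f)\<^sup>2 - sum ?c (G n)) \<longlonglongrightarrow> 0"
  proof -
    have "L2_norm M (\<lambda>x. f x - u n x) = L2_norm M (\<lambda>x. u n x - p x)" for n
    proof -
      have "L2_norm M (\<lambda>x. f x - u n x) = L2_norm M (\<lambda>x. p x - u n x)"
        using ae by (intro L2_norm_cong_AE L2_diff f p u_L2) auto
      then show ?thesis by (simp add: L2_norm_diff_commute)
    qed
    then have "(\<lambda>n. (L2_norm M (\<lambda>x. f x - u n x))\<^sup>2) \<longlonglongrightarrow> 0"
      using tendsto_power[OF p(2), of 2] by simp
    then show ?thesis
      unfolding u_def L2_norm_sub_partial[OF on G(1) G(2) f] .
  qed
  moreover have "(\<lambda>n. (L2_norm M f)\<^sup>2 - sum ?c (G n)) \<longlonglongrightarrow> (L2_norm M f)\<^sup>2 - s"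
  proof (intro tendsto_diff tendsto_const)
    show "(\<lambda>n. sum ?c (G n)) \<longlonglongrightarrow> s"
    proof (rule tendsto_sandwich)
      show "\<forall>\<^sub>F n in sequentially. s - 1 / real (Suc n) \<le> sum ?c (G n)"
        using G(3) by (intro always_eventually allI less_imp_le)
      show "\<forall>\<^sub>F n in sequentially. sum ?c (G n) \<le> s"
        using le_s[OF G(1,2)] by (intro always_eventually allI)
      show "(\<lambda>n. s - 1 / real (Suc n)) \<longlonglongrightarrow> s"
        using tendsto_diff[OF tendsto_const LIMSEQ_Suc[OF lim_1_over_n], of s] by simp
    qed simp
  qed
  ultimately have "(L2_norm M f)\<^sup>2 - s = 0" by (rule LIMSEQ_unique[THEN sym])
  then show ?thesis using s by simp
qed

text \<open>Zorn's lemma above a prescribed family, so that singular vectors can be made part of a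
  basis. A nonzero vector orthogonal to a maximal family could be normalized and added.\<close>

lemma L2_orthonormal_extend:
  assumes "L2_orthonormal M U"
  obtains B where "U \<subseteq> B" "L2_onb M B"
proof -
  let ?S = "{B. U \<subseteq> B \<and> L2_orthonormal M B}"
  have "\<exists>B\<in>?S. \<forall>X\<in>?S. B \<subseteq> X \<longrightarrow> X = B"
  proof (rule subset_Zorn_nonempty)
    show "?S \<noteq> {}" using assms by auto
    fix C assume "C \<noteq> {}" "subset.chain ?S C"
    then have C: "\<And>B. B \<in> C \<Longrightarrow> U \<subseteq> B \<and> L2_orthonormal M B"
      "\<And>A B. A \<in> C \<Longrightarrow> B \<in> C \<Longrightarrow> A \<subseteq> B \<or> B \<subseteq> A"
      by (auto simp: subset_chain_def)
    have "L2_inner M f g = (if f = g then 1 else 0)"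
      if fg: "f \<in> A" "A \<in> C" "g \<in> B" "B \<in> C" for f g A B
    proof -
      obtain D where "D \<in> C" "f \<in> D" "g \<in> D" using C(2)[OF fg(2,4)] fg by blast
      then show ?thesis using C(1)[of D] L2_orthonormalD(2) by blast
    qed
    moreover have "\<Union>C \<subseteq> L2 M" using C(1) L2_orthonormalD(1) by blast
    ultimately have "L2_orthonormal M (\<Union>C)"
      unfolding L2_orthonormal_def by (intro conjI ballI) (assumption, elim UnionE)
    moreover have "U \<subseteq> \<Union>C" using C(1) \<open>C \<noteq> {}\<close> by blast
    ultimately show "\<Union>C \<in> ?S" by simp
  qed
  then obtain B where B: "U \<subseteq> B" "L2_orthonormal M B"
    and max: "\<And>X. U \<subseteq> X \<Longrightarrow> L2_orthonormal M X \<Longrightarrow> B \<subseteq> X \<Longrightarrow> X = B" by auto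
  have "AE x in M. f x = 0" if f: "f \<in> L2 M" and orth: "\<forall>e\<in>B. L2_inner M f e = 0" for f
  proof (rule ccontr)
    assume "\<not> (AE x in M. f x = 0)"
    then have nz: "L2_norm M f \<noteq> 0" using L2_norm_eq_0_AE[OF f] by blast
    define v where "v = (\<lambda>x. complex_of_real (1 / L2_norm M f) * f x)"
    have "v \<in> L2 M" "L2_norm M v = 1"
      using f nz L2_norm_nonneg[of M f] unfolding v_def
      by (auto intro: L2_scale simp del: of_real_divide simp: L2_norm_scale)
    moreover have "L2_inner M v e = 0" if "e \<in> B" for e
      using orth that unfolding v_def by (simp only: L2_inner_scale_left) simp
    ultimately have "L2_orthonormal M (insert v B)" "v \<notin> B"
      using L2_orthonormal_insert[OF B(2)] by blast+
    then show False using max[of "insert v B"] B(1) by blast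
  qed
  then have "L2_onb M B" using B(2) by (simp add: L2_onb_def)
  then show ?thesis using B(1) that by blast
qed

subsection \<open>Sums as integrals over the counting measure\<close>

text \<open>Gives lower bounds for trace norms, which are integrals over a counting measure.\<close>

lemma sum_le_nn_integral_count_space:
  assumes "finite G" "G \<subseteq> A"
  shows "sum f G \<le> (\<integral>\<^sup>+ x. f x \<partial>count_space A)"
proof -
  have "sum f G = (\<Sum>x\<in>G. if x \<in> G then f x else 0)" by (intro sum.cong) auto
  also have "\<dots> = (\<integral>\<^sup>+ x. (if x \<in> G then f x else 0) \<partial>count_space A)"
    using assms by (intro nn_integral_count_space'[symmetric]) auto
  also have "\<dots> \<le> (\<integral>\<^sup>+ x. f x \<partial>count_space A)"
    by (intro nn_integral_mono) auto
  finally show ?thesis .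
qed

lemma nn_integral_count_space_infsum:
  fixes f :: "'a \<Rightarrow> real"
  assumes "f summable_on A" "\<And>x. x \<in> A \<Longrightarrow> 0 \<le> f x"
  shows "(\<integral>\<^sup>+ x. ennreal (f x) \<partial>count_space A) = ennreal (infsum f A)"
proof -
  have "Infinite_Set_Sum.abs_summable_on f A"
    using assms(1) summable_on_iff_abs_summable_on_real abs_summable_equivalent by blast
  then show ?thesis
    using assms(2) by (simp add: nn_integral_conv_infsetsum infsetsum_infsum)
qed

lemma nonneg_summable_on_bounded:
  fixes f :: "'a \<Rightarrow> real"
  assumes "\<And>x. x \<in> A \<Longrightarrow> 0 \<le> f x" "\<And>G. finite G \<Longrightarrow> G \<subseteq> A \<Longrightarrow> sum f G \<le> C"
  shows "f summable_on A" "infsum f A \<le> C"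
proof -
  show "f summable_on A"
    using assms by (intro nonneg_bdd_above_summable_on bdd_aboveI[of _ C]) auto
  then show "infsum f A \<le> C" using assms(2) by (rule infsum_le_finite_sums)
qed

subsection \<open>Operators with an adjoint\<close>

text \<open>For any adjoint \<open>S\<close> of \<open>T\<close> this is the eigenspace of \<open>S T\<close>; the weak form makes no
  reference to the choice of \<open>S\<close>, in particular not to the one in \<open>L2_adjoint\<close>.\<close>

definition L2_gram_eigenspace :: "'a measure \<Rightarrow> 'a L2_op \<Rightarrow> real \<Rightarrow> ('a \<Rightarrow> complex) set" where
  "L2_gram_eigenspace M T c =
     {f \<in> L2 M. \<forall>g\<in>L2 M. L2_inner M (T f) (T g) = complex_of_real c * L2_inner M f g}"

text \<open>Having an adjoint forces linearity up to null sets, so the pair alone is the setting;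
  scaling identities are recovered by moving \<open>T\<close> across the inner product. Besides the
  Fourier operator, the locale is applied to the adjoint picked by \<open>L2_adjoint\<close> and to
  \<open>S T\<close> as its own adjoint.\<close>

locale L2_adjoint_pair =
  fixes M :: "'a measure" and T S :: "'a L2_op"
  assumes T_L2: "f \<in> L2 M \<Longrightarrow> T f \<in> L2 M"
    and adjoint: "L2_is_adjoint M T S"
begin

lemma S_L2: "g \<in> L2 M \<Longrightarrow> S g \<in> L2 M"
  using adjoint by (simp add: L2_is_adjoint_def)

lemma inner_T_left: "f \<in> L2 M \<Longrightarrow> g \<in> L2 M \<Longrightarrow> L2_inner M (T f) g = L2_inner M f (S g)"
  using adjoint by (simp add: L2_is_adjoint_def)

lemma inner_S_left: "f \<in> L2 M \<Longrightarrow> g \<in> L2 M \<Longrightarrow> L2_inner M (S g) f = L2_inner M g (T f)"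
  using inner_T_left[of f g] L2_inner_cnj[of M "S g" f] L2_inner_cnj[of M g "T f"] by simp

lemma inner_ST_left:
  "f \<in> L2 M \<Longrightarrow> g \<in> L2 M \<Longrightarrow> L2_inner M (S (T f)) g = L2_inner M (T f) (T g)"
  by (simp add: inner_S_left T_L2)

lemma inner_ST_right:
  "f \<in> L2 M \<Longrightarrow> g \<in> L2 M \<Longrightarrow> L2_inner M f (S (T g)) = L2_inner M (T f) (T g)"
  by (simp add: inner_T_left T_L2)

lemma gram_eigenspace_L2: "f \<in> L2_gram_eigenspace M T c \<Longrightarrow> f \<in> L2 M"
  by (simp add: L2_gram_eigenspace_def)

lemma gram_eigenspace_inner:
  "f \<in> L2_gram_eigenspace M T c \<Longrightarrow> g \<in> L2 M \<Longrightarrow>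
    L2_inner M (T f) (T g) = complex_of_real c * L2_inner M f g"
  by (simp add: L2_gram_eigenspace_def)

text \<open>Inner products ignore null sets, which gives one inclusion. For the other, the weak
  equation is tested against the defect \<open>h = S (T f) - c f\<close> itself, so
  \<open>L2_inner M h h = 0\<close>.\<close>

lemma eigenspace_eq_gram:
  "L2_eigenspace M (\<lambda>f. S (T f)) (complex_of_real c) = L2_gram_eigenspace M T c"
proof (intro set_eqI iffI)
  fix f assume "f \<in> L2_eigenspace M (\<lambda>f. S (T f)) (complex_of_real c)"
  then have f: "f \<in> L2 M" "AE x in M. S (T f) x = complex_of_real c * f x"
    by (auto simp: L2_eigenspace_def)
  have "L2_inner M (T f) (T g) = complex_of_real c * L2_inner M f g" if g: "g \<in> L2 M" for g
  proof -
    have "L2_inner M (S (T f)) g = L2_inner M (\<lambda>x. complex_of_real c * f x) g"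
      by (intro L2_inner_cong_AE S_L2 T_L2 L2_scale f g)
    then show ?thesis by (simp add: inner_ST_left f g L2_inner_scale_left)
  qed
  then show "f \<in> L2_gram_eigenspace M T c" using f by (simp add: L2_gram_eigenspace_def)
next
  fix f assume f: "f \<in> L2_gram_eigenspace M T c"
  note fL = gram_eigenspace_L2[OF f]
  define h where "h x = S (T f) x - complex_of_real c * f x" for x
  have L: "S (T f) \<in> L2 M" "(\<lambda>x. complex_of_real c * f x) \<in> L2 M"
    by (intro S_L2 T_L2 L2_scale fL)+
  then have h: "h \<in> L2 M" unfolding h_def[abs_def] by (rule L2_diff)
  have "L2_inner M h h = L2_inner M (S (T f)) h - complex_of_real c * L2_inner M f h"
    using L2_inner_diff_left[OF L h] by (simp add: h_def[abs_def] L2_inner_scale_left)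
  then have "L2_inner M h h = 0"
    by (simp add: inner_ST_left fL h gram_eigenspace_inner[OF f])
  then have "L2_norm M h = 0" by (simp add: L2_inner_self)
  then have "AE x in M. h x = 0" by (rule L2_norm_eq_0_AE[OF h])
  then show "f \<in> L2_eigenspace M (\<lambda>f. S (T f)) (complex_of_real c)"
    using fL by (simp add: L2_eigenspace_def h_def)
qed

lemma gram_eigenspace_orthogonal:
  assumes "f \<in> L2_gram_eigenspace M T c" "g \<in> L2_gram_eigenspace M T d" "c \<noteq> d"
  shows "L2_inner M f g = 0"
proof -
  have fg: "f \<in> L2 M" "g \<in> L2 M" using assms gram_eigenspace_L2 by blast+
  have "complex_of_real c * L2_inner M f g = L2_inner M (T f) (T g)"
    by (rule gram_eigenspace_inner[OF assms(1) fg(2), symmetric])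
  also have "\<dots> = cnj (L2_inner M (T g) (T f))" by (rule L2_inner_cnj)
  also have "\<dots> = complex_of_real d * L2_inner M f g"
    using gram_eigenspace_inner[OF assms(2) fg(1)] L2_inner_cnj[of M f g] by simp
  finally show ?thesis using assms(3) by simp
qed

lemma gram_eigenspace_norm:
  assumes "f \<in> L2_gram_eigenspace M T c"
  shows "(L2_norm M (T f))\<^sup>2 = c * (L2_norm M f)\<^sup>2"
  using gram_eigenspace_inner[OF assms gram_eigenspace_L2[OF assms]]
  by (simp only: L2_inner_self of_real_mult[symmetric] of_real_eq_iff)

lemma gram_eigenspace_scale:
  assumes "f \<in> L2_gram_eigenspace M T c"
  shows "(\<lambda>x. a * f x) \<in> L2_gram_eigenspace M T c"
proof -
  note f = gram_eigenspace_L2[OF assms]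
  have "L2_inner M (T (\<lambda>x. a * f x)) (T g) = complex_of_real c * L2_inner M (\<lambda>x. a * f x) g"
    if g: "g \<in> L2 M" for g
  proof -
    have "L2_inner M (T (\<lambda>x. a * f x)) (T g) = a * L2_inner M f (S (T g))"
      using f g by (simp add: inner_T_left L2_scale T_L2 L2_inner_scale_left)
    also have "\<dots> = a * (complex_of_real c * L2_inner M f g)"
      by (simp add: inner_ST_right f g gram_eigenspace_inner[OF assms g])
    finally show ?thesis by (simp add: L2_inner_scale_left)
  qed
  then show ?thesis by (simp add: L2_gram_eigenspace_def L2_scale f)
qed

lemma norm_T_scale:
  assumes f: "f \<in> L2 M"
  shows "L2_norm M (T (\<lambda>x. a * f x)) = cmod a * L2_norm M (T f)"
proof -
  have af: "(\<lambda>x. a * f x) \<in> L2 M" by (rule L2_scale[OF f])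
  have "L2_inner M (T (\<lambda>x. a * f x)) (T (\<lambda>x. a * f x)) = a * L2_inner M f (S (T (\<lambda>x. a * f x)))"
    by (simp add: inner_T_left af T_L2 L2_inner_scale_left)
  also have "L2_inner M f (S (T (\<lambda>x. a * f x))) = L2_inner M (S (T f)) (\<lambda>x. a * f x)"
    by (simp add: inner_ST_right inner_ST_left f af)
  also have "\<dots> = cnj a * L2_inner M (T f) (T f)"
    by (simp add: L2_inner_scale_right inner_ST_left f)
  finally have "complex_of_real ((L2_norm M (T (\<lambda>x. a * f x)))\<^sup>2)
      = complex_of_real ((cmod a)\<^sup>2) * complex_of_real ((L2_norm M (T f))\<^sup>2)"
    by (simp only: L2_inner_self complex_norm_square mult.assoc)
  then have "(L2_norm M (T (\<lambda>x. a * f x)))\<^sup>2 = (cmod a * L2_norm M (T f))\<^sup>2"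
    by (simp only: of_real_mult[symmetric] of_real_eq_iff power_mult_distrib)
  then show ?thesis by (simp add: L2_norm_nonneg)
qed

text \<open>With \<open>w = S f - S g\<close> the adjoint relation gives
  \<open>L2_inner M w w = L2_inner M (f - g) (T w)\<close>; Cauchy-Schwarz and division by the norm
  of \<open>w\<close> finish. The form for differences is the one used on convergent
  sequences.\<close>

lemma norm_S_le:
  assumes C: "\<And>f. f \<in> L2 M \<Longrightarrow> L2_norm M (T f) \<le> C * L2_norm M f"
    and f: "f \<in> L2 M" and g: "g \<in> L2 M"
  shows "L2_norm M (\<lambda>x. S f x - S g x) \<le> C * L2_norm M (\<lambda>x. f x - g x)"
proof -
  define w where "w x = S f x - S g x" for x
  define h where "h x = f x - g x" for x
  have w: "w \<in> L2 M" and h: "h \<in> L2 M"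
    unfolding w_def[abs_def] h_def[abs_def] by (intro L2_diff S_L2 f g)+
  have "L2_inner M w w = L2_inner M (S f) w - L2_inner M (S g) w"
    using L2_inner_diff_left[OF S_L2[OF f] S_L2[OF g] w] by (simp add: w_def[abs_def])
  also have "\<dots> = L2_inner M h (T w)"
    using L2_inner_diff_left[OF f g T_L2[OF w]] by (simp add: inner_S_left f g w h_def[abs_def])
  finally have "(L2_norm M w)\<^sup>2 = cmod (L2_inner M h (T w))"
    by (metis L2_inner_self norm_of_real abs_power2)
  also have "\<dots> \<le> L2_norm M h * (C * L2_norm M w)"
    using L2_Cauchy_Schwarz[OF h T_L2[OF w]] mult_left_mono[OF C[OF w] L2_norm_nonneg[of M h]]
    by linarith
  finally have le: "L2_norm M w * L2_norm M w \<le> (C * L2_norm M h) * L2_norm M w"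
    by (simp add: power2_eq_square mult_ac)
  show ?thesis
  proof (cases "L2_norm M w = 0")
    case True
    \<comment> \<open>The sign of \<open>C\<close> is unknown; the bound for \<open>T h\<close>
      makes the right-hand side nonnegative.\<close>
    have "0 \<le> C * L2_norm M h"
      using C[OF h] L2_norm_nonneg[of M "T h"] by linarith
    then show ?thesis using True by (simp add: w_def[abs_def] h_def[abs_def])
  next
    case False
    then have "0 < L2_norm M w" using L2_norm_nonneg[of M w] by simp
    then have "L2_norm M w \<le> C * L2_norm M h" using le by simp
    then show ?thesis by (simp add: w_def[abs_def] h_def[abs_def])
  qed
qed

text \<open>The vector is the limit of a maximizing sequence \<open>u\<^sub>n\<close> for \<open>\<parallel>T f\<parallel>\<^sup>2\<close> on the unit sphere of
  the orthogonal complement of \<open>U\<close>: if \<open>c\<close> is the supremum, then \<open>S (T u\<^sub>n) - c u\<^sub>n\<close> tends to 0,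
  while \<open>S (T u\<^sub>n)\<close> converges along a subsequence.\<close>

lemma exists_orthogonal_eigenvector:
  assumes compact: "L2_compact M T"
    and U: "\<And>e. e \<in> U \<Longrightarrow> \<exists>d. e \<in> L2_gram_eigenspace M T d"
    and f0: "f0 \<in> L2 M" "\<And>e. e \<in> U \<Longrightarrow> L2_inner M f0 e = 0" "L2_norm M (T f0) \<noteq> 0"
  obtains c v where "c > 0" "v \<in> L2_gram_eigenspace M T c" "L2_norm M v = 1"
    "\<And>e. e \<in> U \<Longrightarrow> L2_inner M v e = 0"
proof -
  have UL: "e \<in> L2 M" if "e \<in> U" for e using U[OF that] gram_eigenspace_L2 by blast
  obtain C where C: "\<And>f. f \<in> L2 M \<Longrightarrow> L2_norm M (T f) \<le> C * L2_norm M f"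
    using compact unfolding L2_compact_def L2_operator_def by blast
  define H where "H = {f \<in> L2 M. \<forall>e\<in>U. L2_inner M f e = 0}"
  have HD: "f \<in> L2 M" "e \<in> U \<Longrightarrow> L2_inner M f e = 0" if "f \<in> H" for f e
    using that by (auto simp: H_def)
  have H_scale: "(\<lambda>x. a * f x) \<in> H" if "f \<in> H" for a f
    using that by (simp add: H_def L2_scale L2_inner_scale_left)
  \<comment> \<open>\<open>U\<close> consists of eigenvectors, so its orthogonal complement is
    invariant and the bound \<open>T_le\<close> applies to \<open>S (T f)\<close> as well.\<close>
  have H_ST: "S (T f) \<in> H" if f: "f \<in> H" for f
  proof -
    have "L2_inner M (S (T f)) e = 0" if e: "e \<in> U" for e
    proof -
      obtain d where "e \<in> L2_gram_eigenspace M T d" using U[OF e] by blast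
      then have "L2_inner M (T e) (T f) = complex_of_real d * L2_inner M e f"
        by (rule gram_eigenspace_inner[OF _ HD(1)[OF f]])
      then have "L2_inner M (T e) (T f) = 0"
        using HD(2)[OF f e] L2_inner_cnj[of M e f] by simp
      then show ?thesis
        using L2_inner_cnj[of M "T f" "T e"] by (simp add: inner_ST_left HD(1)[OF f] UL[OF e])
    qed
    then show ?thesis by (simp add: H_def S_L2 T_L2 HD(1)[OF f])
  qed
  have unit: "\<exists>a. a > 0 \<and> L2_norm M (\<lambda>x. complex_of_real a * f x) = 1 \<and> a * L2_norm M f = 1"
    if "L2_norm M f \<noteq> 0" for f
    using that L2_norm_nonneg[of M f]
    by (intro exI[of _ "1 / L2_norm M f"]) (simp add: L2_norm_scale del: of_real_divide)
  define W where "W = {(L2_norm M (T f))\<^sup>2 | f. f \<in> H \<and> L2_norm M f = 1}"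
  have W_bdd: "bdd_above W"
  proof (rule bdd_aboveI)
    fix y assume "y \<in> W"
    then obtain f where f: "y = (L2_norm M (T f))\<^sup>2" "f \<in> H" "L2_norm M f = 1" by (auto simp: W_def)
    then show "y \<le> C\<^sup>2"
      using C[OF HD(1)[OF f(2)]] by (auto intro!: power_mono simp: L2_norm_nonneg)
  qed
  have f0H: "f0 \<in> H" using f0 by (simp add: H_def)
  have "L2_norm M f0 \<noteq> 0"
    using C[OF f0(1)] f0(3) L2_norm_nonneg[of M "T f0"] by auto
  then obtain a0 where a0: "a0 > 0" "L2_norm M (\<lambda>x. complex_of_real a0 * f0 x) = 1"
    using unit by blast
  define c where "c = Sup W"
  have W0: "(a0 * L2_norm M (T f0))\<^sup>2 \<in> W"
    using a0 H_scale[OF f0H, of "complex_of_real a0"] norm_T_scale[OF f0(1), of "complex_of_real a0"]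
    unfolding W_def by force
  then have "(a0 * L2_norm M (T f0))\<^sup>2 \<le> c" unfolding c_def by (rule cSup_upper[OF _ W_bdd])
  moreover have "(a0 * L2_norm M (T f0))\<^sup>2 > 0" using a0 f0(3) by simp
  ultimately have c: "c > 0" by linarith
  have T_le: "(L2_norm M (T f))\<^sup>2 \<le> c * (L2_norm M f)\<^sup>2" if f: "f \<in> H" for f
  proof (cases "L2_norm M f = 0")
    case True
    then have "L2_norm M (T f) = 0"
      using C[OF HD(1)[OF f]] L2_norm_nonneg[of M "T f"] by simp
    then show ?thesis by (simp add: True)
  next
    case False
    then obtain a where a: "a > 0" "L2_norm M (\<lambda>x. complex_of_real a * f x) = 1" "a * L2_norm M f = 1"
      using unit by blast
    have "(a * L2_norm M (T f))\<^sup>2 \<in> W"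
      using a H_scale[OF f, of "complex_of_real a"] norm_T_scale[OF HD(1)[OF f], of "complex_of_real a"]
      unfolding W_def by force
    then have "(a * L2_norm M (T f))\<^sup>2 \<le> c" unfolding c_def by (rule cSup_upper[OF _ W_bdd])
    also have "c = c * (a * L2_norm M f)\<^sup>2" using a(3) by simp
    finally have "a\<^sup>2 * (L2_norm M (T f))\<^sup>2 \<le> a\<^sup>2 * (c * (L2_norm M f)\<^sup>2)"
      by (simp add: power_mult_distrib mult_ac)
    then show ?thesis using a(1) by simp
  qed
  \<comment> \<open>The bound \<open>T_le\<close> enters twice, for \<open>f\<close> and for
    \<open>S (T f)\<close>. The sharp constant \<open>c\<close> is what lets the terms in
    \<open>v_ST\<close> cancel.\<close>
  have ST_le: "L2_norm M (S (T f)) \<le> c" if f: "f \<in> H" "L2_norm M f = 1" for f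
  proof -
    note fL = HD(1)[OF f(1)]
    have STf: "S (T f) \<in> L2 M" by (intro S_L2 T_L2 fL)
    have Tf: "L2_norm M (T f) \<le> sqrt c"
      using T_le[OF f(1)] f(2) by (intro real_le_rsqrt) simp
    have TST: "L2_norm M (T (S (T f))) \<le> sqrt c * L2_norm M (S (T f))"
    proof (rule power2_le_imp_le)
      show "(L2_norm M (T (S (T f))))\<^sup>2 \<le> (sqrt c * L2_norm M (S (T f)))\<^sup>2"
        using T_le[OF H_ST[OF f(1)]] c by (simp add: power_mult_distrib)
    qed (use c in \<open>simp add: L2_norm_nonneg\<close>)
    have "(L2_norm M (S (T f)))\<^sup>2 = cmod (L2_inner M (T f) (T (S (T f))))"
      by (simp only: inner_ST_left[OF fL STf, symmetric] L2_inner_self norm_of_real abs_power2)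
    also have "\<dots> \<le> L2_norm M (T f) * L2_norm M (T (S (T f)))"
      by (intro L2_Cauchy_Schwarz T_L2 fL STf)
    also have "\<dots> \<le> sqrt c * (sqrt c * L2_norm M (S (T f)))"
      using c by (intro mult_mono Tf TST) (auto simp: L2_norm_nonneg)
    also have "\<dots> = c * L2_norm M (S (T f))"
      using c by (simp add: mult.assoc[symmetric])
    finally have "L2_norm M (S (T f)) * L2_norm M (S (T f)) \<le> c * L2_norm M (S (T f))"
      by (simp add: power2_eq_square)
    then show ?thesis
      using c L2_norm_nonneg[of M "S (T f)"] by (cases "L2_norm M (S (T f)) = 0") auto
  qed
  have "\<exists>f. f \<in> H \<and> L2_norm M f = 1 \<and> c - 1 / real (Suc n) < (L2_norm M (T f))\<^sup>2" for n
  proof -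
    have "c - 1 / real (Suc n) < Sup W" by (simp add: c_def)
    then obtain y where "y \<in> W" "c - 1 / real (Suc n) < y"
      using less_cSup_iff[OF _ W_bdd] W0 by blast
    then show ?thesis by (auto simp: W_def)
  qed
  then obtain u where u: "\<And>n. u n \<in> H" "\<And>n. L2_norm M (u n) = 1"
    "\<And>n. c - 1 / real (Suc n) < (L2_norm M (T (u n)))\<^sup>2" by metis
  note uL = HD(1)[OF u(1)]
  have ST_uL: "S (T (u n)) \<in> L2 M" for n by (intro S_L2 T_L2 uL)
  have "(\<forall>n. u n \<in> L2 M) \<and> (\<exists>K. \<forall>n. L2_norm M (u n) \<le> K)"
    using uL u(2) by (auto intro: exI[of _ 1])
  then obtain r g where g: "g \<in> L2 M" "strict_mono r"
    and lim_g: "(\<lambda>n. L2_norm M (\<lambda>x. T (u (r n)) x - g x)) \<longlonglongrightarrow> 0"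
    using compact unfolding L2_compact_def by blast
  define w where "w = S g"
  have w: "w \<in> L2 M" by (simp add: w_def S_L2 g)
  have lim_Aw: "(\<lambda>n. L2_norm M (\<lambda>x. S (T (u (r n))) x - w x)) \<longlonglongrightarrow> 0"
  proof (rule Lim_null_comparison)
    show "\<forall>\<^sub>F n in sequentially. norm (L2_norm M (\<lambda>x. S (T (u (r n))) x - w x))
        \<le> C * L2_norm M (\<lambda>x. T (u (r n)) x - g x)"
      using norm_S_le[OF C T_L2[OF uL] g(1)]
      by (intro always_eventually allI) (simp add: w_def L2_norm_nonneg)
    show "(\<lambda>n. C * L2_norm M (\<lambda>x. T (u (r n)) x - g x)) \<longlonglongrightarrow> 0"
      using tendsto_mult_left[OF lim_g, of C] by simp
  qed
  let ?v = "\<lambda>n x. complex_of_real c * u (r n) x"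
  have vL: "?v n \<in> L2 M" for n by (intro L2_scale uL)
  \<comment> \<open>The squared distance is at most twice
    \<open>c^2 - c * (L2_norm M (T ?u))^2\<close>, and near-maximality makes the subtracted term
    close to \<open>c^2\<close>.\<close>
  have v_ST: "L2_norm M (\<lambda>x. ?v n x - S (T (u (r n))) x) \<le> sqrt (2 * c / real (Suc n))" for n
  proof (rule real_le_rsqrt)
    let ?u = "u (r n)"
    have "L2_inner M (?v n) (S (T ?u)) = complex_of_real (c * (L2_norm M (T ?u))\<^sup>2)"
      by (simp add: L2_inner_scale_left inner_ST_right uL L2_inner_self)
    then have "(L2_norm M (\<lambda>x. ?v n x - S (T ?u) x))\<^sup>2
        = c\<^sup>2 - 2 * (c * (L2_norm M (T ?u))\<^sup>2) + (L2_norm M (S (T ?u)))\<^sup>2"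
      by (simp add: L2_norm_diff_sq[OF vL ST_uL] L2_norm_scale u(2))
    also have "\<dots> \<le> c\<^sup>2 - 2 * (c * (c - 1 / real (Suc n))) + c\<^sup>2"
    proof -
      have "1 / real (Suc (r n)) \<le> 1 / real (Suc n)"
        using seq_suble[OF g(2), of n] by (auto intro!: divide_left_mono)
      then have "c - 1 / real (Suc n) \<le> (L2_norm M (T ?u))\<^sup>2" using u(3)[of "r n"] by linarith
      then have "c * (c - 1 / real (Suc n)) \<le> c * (L2_norm M (T ?u))\<^sup>2"
        using c by (intro mult_left_mono) auto
      moreover have "(L2_norm M (S (T ?u)))\<^sup>2 \<le> c\<^sup>2"
        by (intro power_mono ST_le u L2_norm_nonneg)
      ultimately show ?thesis by linarith
    qed
    also have "\<dots> = 2 * c / real (Suc n)" by (simp add: algebra_simps power2_eq_square)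
    finally show "(L2_norm M (\<lambda>x. ?v n x - S (T ?u) x))\<^sup>2 \<le> 2 * c / real (Suc n)" .
  qed
  have lim_vw: "(\<lambda>n. L2_norm M (\<lambda>x. ?v n x - w x)) \<longlonglongrightarrow> 0"
  proof (rule Lim_null_comparison)
    show "\<forall>\<^sub>F n in sequentially. norm (L2_norm M (\<lambda>x. ?v n x - w x))
        \<le> sqrt (2 * c / real (Suc n)) + L2_norm M (\<lambda>x. S (T (u (r n))) x - w x)"
    proof (intro always_eventually allI)
      fix n
      show "norm (L2_norm M (\<lambda>x. ?v n x - w x))
          \<le> sqrt (2 * c / real (Suc n)) + L2_norm M (\<lambda>x. S (T (u (r n))) x - w x)"
        using L2_norm_diff_triangle[OF vL ST_uL w, of n "r n"] v_ST[of n]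
          L2_norm_nonneg[of M "\<lambda>x. ?v n x - w x"] by (simp only: real_norm_def abs_of_nonneg)
    qed
    have "(\<lambda>n. 2 * c * (1 / real (Suc n))) \<longlonglongrightarrow> 2 * c * 0"
      using LIMSEQ_Suc[OF lim_1_over_n] by (intro tendsto_mult tendsto_const) simp
    then have "(\<lambda>n. sqrt (2 * c / real (Suc n))) \<longlonglongrightarrow> sqrt 0"
      by (intro tendsto_real_sqrt) simp
    then show "(\<lambda>n. sqrt (2 * c / real (Suc n)) + L2_norm M (\<lambda>x. S (T (u (r n))) x - w x)) \<longlonglongrightarrow> 0"
      using tendsto_add[OF _ lim_Aw] by fastforce
  qed
  have w_norm: "L2_norm M w = c"
  proof -
    have "(\<lambda>n. L2_norm M (?v n)) \<longlonglongrightarrow> L2_norm M w" by (rule L2_tendsto_norm[OF vL w lim_vw])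
    moreover have "L2_norm M (?v n) = c" for n using c by (simp add: L2_norm_scale u(2))
    ultimately show ?thesis by (simp add: LIMSEQ_const_iff)
  qed
  have w_H: "L2_inner M w e = 0" if e: "e \<in> U" for e
  proof -
    have "(\<lambda>n. L2_inner M (?v n) e) \<longlonglongrightarrow> L2_inner M w e"
      by (rule L2_tendsto_inner[OF vL w UL[OF e] lim_vw])
    moreover have "L2_inner M (?v n) e = 0" for n
      by (simp add: L2_inner_scale_left HD(2)[OF u(1) e])
    ultimately show ?thesis by (simp add: LIMSEQ_const_iff)
  qed
  have w_eig: "w \<in> L2_gram_eigenspace M T c"
  proof -
    have "L2_inner M (T w) (T h) = complex_of_real c * L2_inner M w h" if h: "h \<in> L2 M" for h
    proof -
      have STh: "S (T h) \<in> L2 M" by (intro S_L2 T_L2 h)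
      have "(\<lambda>n. L2_inner M (?v n) (S (T h))) \<longlonglongrightarrow> L2_inner M w (S (T h))"
        by (rule L2_tendsto_inner[OF vL w STh lim_vw])
      moreover have "L2_inner M (?v n) (S (T h)) = complex_of_real c * L2_inner M (S (T (u (r n)))) h" for n
        by (simp add: L2_inner_scale_left inner_ST_left inner_ST_right uL h)
      moreover have "(\<lambda>n. complex_of_real c * L2_inner M (S (T (u (r n)))) h) \<longlonglongrightarrow> complex_of_real c * L2_inner M w h"
        by (intro tendsto_mult tendsto_const L2_tendsto_inner[OF ST_uL w h lim_Aw])
      ultimately have "L2_inner M w (S (T h)) = complex_of_real c * L2_inner M w h"
        using LIMSEQ_unique by simp blast
      then show ?thesis by (simp add: inner_ST_right w h)
    qed
    then show ?thesis by (simp add: L2_gram_eigenspace_def w)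
  qed
  show ?thesis
  proof (rule that[OF c])
    show "(\<lambda>x. complex_of_real (1 / c) * w x) \<in> L2_gram_eigenspace M T c"
      by (rule gram_eigenspace_scale[OF w_eig])
    show "L2_norm M (\<lambda>x. complex_of_real (1 / c) * w x) = 1"
      using c w_norm by (simp add: L2_norm_scale del: of_real_divide)
    show "L2_inner M (\<lambda>x. complex_of_real (1 / c) * w x) e = 0" if "e \<in> U" for e
      using w_H[OF that] by (simp only: L2_inner_scale_left) simp
  qed
qed

end

subsection \<open>Singular values\<close>

text \<open>A bounded set of cardinalities has a maximum. A family of maximal cardinality cannot be
  enlarged, so no unit vector of \<open>V\<close> is orthogonal to it; this clause later contradicts
  the existence of a further eigenvector.\<close>

lemma L2_dim_attained:
  assumes V: "V \<subseteq> L2 M"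
    and bd: "\<And>B. finite B \<Longrightarrow> B \<subseteq> V \<Longrightarrow> L2_orthonormal M B \<Longrightarrow> card B \<le> N"
  obtains B where "finite B" "B \<subseteq> V" "L2_orthonormal M B" "L2_dim M V = of_nat (card B)"
    "\<And>v. v \<in> V \<Longrightarrow> L2_norm M v = 1 \<Longrightarrow> \<exists>e\<in>B. L2_inner M v e \<noteq> 0"
proof -
  let ?P = "\<lambda>n. \<exists>B. finite B \<and> B \<subseteq> V \<and> L2_orthonormal M B \<and> card B = n"
  have "?P 0" by (intro exI[of _ "{}"]) (simp add: L2_orthonormal_def)
  moreover have "\<forall>n. ?P n \<longrightarrow> n \<le> N" using bd by blast
  ultimately obtain n where "?P n" and max: "\<And>m. ?P m \<Longrightarrow> m \<le> n"
    using Nat.ex_has_greatest_nat[of ?P 0 N] by blast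
  then obtain B where B: "finite B" "B \<subseteq> V" "L2_orthonormal M B" and n: "card B = n" by blast
  have "L2_dim M V = of_nat (card B)"
    unfolding L2_dim_def
  proof (rule antisym)
    have "card B' \<le> card B" if "finite B'" "B' \<subseteq> V" "L2_orthonormal M B'" for B'
      using max[of "card B'"] that n by blast
    then show "(SUP B'\<in>{B. finite B \<and> B \<subseteq> V \<and> L2_orthonormal M B}. of_nat (card B')) \<le> (of_nat (card B) :: ennreal)"
      by (intro SUP_least) auto
    show "of_nat (card B) \<le> (SUP B'\<in>{B. finite B \<and> B \<subseteq> V \<and> L2_orthonormal M B}. of_nat (card B') :: ennreal)"
      using B by (intro SUP_upper) auto
  qed
  moreover have "\<exists>e\<in>B. L2_inner M v e \<noteq> 0" if v: "v \<in> V" "L2_norm M v = 1" for v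
  proof (rule ccontr)
    assume "\<not> (\<exists>e\<in>B. L2_inner M v e \<noteq> 0)"
    then have "L2_orthonormal M (insert v B)" "v \<notin> B"
      using L2_orthonormal_insert[OF B(3) _ v(2)] V v(1) by auto
    then have "?P (Suc n)"
      using B v n by (intro exI[of _ "insert v B"]) auto
    then show False using max[of "Suc n"] by simp
  qed
  ultimately show ?thesis using B that by blast
qed

context L2_adjoint_pair
begin

text \<open>The adjoint inside \<open>L2_singular_mult\<close> is an arbitrary choice, but it is an
  adjoint because \<open>S\<close> is one, and the weak eigenspace is the same for all of
  them.\<close>

lemma singular_mult_eq: "L2_singular_mult M T s = L2_dim M (L2_gram_eigenspace M T (s\<^sup>2))"
proof -
  have "L2_is_adjoint M T (L2_adjoint M T)"
    unfolding L2_adjoint_def by (rule someI[of _ S]) (rule adjoint)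
  then interpret A: L2_adjoint_pair M T "L2_adjoint M T"
    by unfold_locales (simp_all add: T_L2)
  show ?thesis
    unfolding L2_singular_mult_def by (simp only: A.eigenspace_eq_gram)
qed

text \<open>Finite multiplicities allow a maximal orthonormal family for each singular value. Since
  squaring is injective on positive numbers, families for different values belong to different
  eigenvalues and are mutually orthogonal.\<close>

lemma singular_vectors:
  assumes bd: "\<And>s. s > 0 \<Longrightarrow> \<exists>N. \<forall>B. finite B \<longrightarrow> B \<subseteq> L2_gram_eigenspace M T (s\<^sup>2) \<longrightarrow>
      L2_orthonormal M B \<longrightarrow> card B \<le> N"
  obtains B where
    "\<And>s. s > 0 \<Longrightarrow> finite (B s)"
    "\<And>s. s > 0 \<Longrightarrow> B s \<subseteq> L2_gram_eigenspace M T (s\<^sup>2)"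
    "\<And>s. s > 0 \<Longrightarrow> L2_singular_mult M T s = of_nat (card (B s))"
    "\<And>s v. s > 0 \<Longrightarrow> v \<in> L2_gram_eigenspace M T (s\<^sup>2) \<Longrightarrow> L2_norm M v = 1 \<Longrightarrow>
      \<exists>e\<in>B s. L2_inner M v e \<noteq> 0"
    "L2_orthonormal M (\<Union>s\<in>{0<..}. B s)"
proof -
  let ?E = "\<lambda>s. L2_gram_eigenspace M T (s\<^sup>2)"
  let ?Q = "\<lambda>s B. finite B \<and> B \<subseteq> ?E s \<and> L2_orthonormal M B \<and> L2_dim M (?E s) = of_nat (card B) \<and>
      (\<forall>v. v \<in> ?E s \<longrightarrow> L2_norm M v = 1 \<longrightarrow> (\<exists>e\<in>B. L2_inner M v e \<noteq> 0))"
  have ex: "\<exists>B. ?Q s B" if s: "s > 0" for s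
  proof -
    obtain N where N: "\<And>B. finite B \<Longrightarrow> B \<subseteq> ?E s \<Longrightarrow> L2_orthonormal M B \<Longrightarrow> card B \<le> N"
      using bd[OF s] by blast
    have "?E s \<subseteq> L2 M" using gram_eigenspace_L2 by blast
    then show ?thesis by (rule L2_dim_attained[OF _ N]) blast+
  qed
  define B where "B s = (SOME B. ?Q s B)" for s
  have B: "?Q s (B s)" if "s > 0" for s
    unfolding B_def by (rule someI_ex[OF ex[OF that]])
  have "L2_inner M f g = (if f = g then 1 else 0)"
    if fg: "f \<in> B s" "s > 0" "g \<in> B t" "t > 0" for f g s t
  proof (cases "s = t")
    case True
    have "L2_orthonormal M (B s)" using B[OF fg(2)] by blast
    then show ?thesis using fg True L2_orthonormalD(2) by blast
  next
    case False
    then have "s\<^sup>2 \<noteq> t\<^sup>2" using fg by (simp add: power2_eq_iff)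
    moreover have fE: "f \<in> ?E s" and gE: "g \<in> ?E t" using B fg by blast+
    ultimately have 0: "L2_inner M f g = 0" using gram_eigenspace_orthogonal by blast
    have "L2_norm M f = 1" using B[OF fg(2)] fg(1) L2_orthonormal_norm by blast
    then have "f \<noteq> g" using 0 by (auto simp: L2_inner_self)
    then show ?thesis using 0 by simp
  qed
  moreover have "(\<Union>s\<in>{0<..}. B s) \<subseteq> L2 M"
  proof
    fix f assume "f \<in> (\<Union>s\<in>{0<..}. B s)"
    then obtain s where "s > 0" "f \<in> B s" by auto
    then show "f \<in> L2 M" using B[of s] gram_eigenspace_L2 by blast
  qed
  ultimately have "L2_orthonormal M (\<Union>s\<in>{0<..}. B s)"
    unfolding L2_orthonormal_def by (intro conjI ballI) (assumption, elim UN_E, simp)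
  with B show ?thesis
    using that[of B] by (simp add: singular_mult_eq)
qed

text \<open>The weight \<open>w\<close> reads the singular value off a unit singular vector, which
  turns sums of singular values into sums over orthonormal families. The bound \<open>C\<close> also
  makes each multiplicity finite, as a family of \<open>n\<close> vectors for \<open>s\<close>
  contributes \<open>n * s\<close>.\<close>

lemma trace_norm_le:
  assumes compact: "L2_compact M T"
    and w: "\<And>s e. s > 0 \<Longrightarrow> e \<in> L2_gram_eigenspace M T (s\<^sup>2) \<Longrightarrow> L2_norm M e = 1 \<Longrightarrow> w e = s"
    and C: "\<And>G. finite G \<Longrightarrow> L2_orthonormal M G \<Longrightarrow> sum w G \<le> C"
  shows "L2_trace_norm M T \<le> ennreal C"
proof -
  have bd: "\<exists>N. \<forall>B. finite B \<longrightarrow> B \<subseteq> L2_gram_eigenspace M T (s\<^sup>2) \<longrightarrow> L2_orthonormal M B \<longrightarrow> card B \<le> N"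
    if s: "s > 0" for s
  proof (intro exI allI impI)
    fix B assume B: "finite B" "B \<subseteq> L2_gram_eigenspace M T (s\<^sup>2)" "L2_orthonormal M B"
    have "w e = s" if "e \<in> B" for e
      using w[OF s] B(2) L2_orthonormal_norm[OF B(3) that] that by blast
    then have "real (card B) * s \<le> C" using C[OF B(1,3)] by simp
    then have "real (card B) \<le> C / s" using s by (simp add: field_simps)
    then show "card B \<le> nat \<lfloor>C / s\<rfloor>" by (simp add: le_nat_floor)
  qed
  obtain B where B: "\<And>s. s > 0 \<Longrightarrow> finite (B s)"
      "\<And>s. s > 0 \<Longrightarrow> B s \<subseteq> L2_gram_eigenspace M T (s\<^sup>2)"
      "\<And>s. s > 0 \<Longrightarrow> L2_singular_mult M T s = of_nat (card (B s))"
    and "\<And>s v. s > 0 \<Longrightarrow> v \<in> L2_gram_eigenspace M T (s\<^sup>2) \<Longrightarrow> L2_norm M v = 1 \<Longrightarrow>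
      \<exists>e\<in>B s. L2_inner M v e \<noteq> 0"
    and on: "L2_orthonormal M (\<Union>s\<in>{0<..}. B s)"
    using singular_vectors[OF bd] by metis
  have wB: "w e = s" if "s > 0" "e \<in> B s" for s e
    using w[OF that(1)] B(2)[OF that(1)] that L2_orthonormal_norm[OF on] by blast
  define f where "f s = s * real (card (B s))" for s
  have sum_f: "sum f G \<le> C" if G: "finite G" "G \<subseteq> {0<..}" for G
  proof -
    have "sum f G = (\<Sum>s\<in>G. sum w (B s))"
      using G(2) wB by (intro sum.cong) (auto simp: f_def subset_iff)
    \<comment> \<open>\<open>w\<close> has the value \<open>s\<close> on \<open>B s\<close>, so
      families for different \<open>s\<close> are disjoint.\<close>
    also have "\<dots> = sum w (\<Union>s\<in>G. B s)"
      using G B(1) wB by (intro sum.UNION_disjoint[symmetric]) (auto simp: subset_iff, metis)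
    also have "\<dots> \<le> C"
    proof (rule C)
      show "finite (\<Union>s\<in>G. B s)" using G B(1) by auto
      show "L2_orthonormal M (\<Union>s\<in>G. B s)"
        using G(2) by (intro L2_orthonormal_subset[OF on] UN_mono) auto
    qed
    finally show ?thesis .
  qed
  have f_nonneg: "0 \<le> f s" if "s \<in> {0<..}" for s using that by (simp add: f_def)
  have "L2_trace_norm M T = (\<integral>\<^sup>+ s. ennreal (f s) \<partial>count_space {0<..})"
    unfolding L2_trace_norm_def using compact
    by (auto simp: B(3) f_def ennreal_mult' ennreal_of_nat_eq_real_of_nat intro!: nn_integral_cong)
  also have "\<dots> = ennreal (infsum f {0<..})"
    by (intro nn_integral_count_space_infsum nonneg_summable_on_bounded(1)[of _ f C] f_nonneg sum_f)
  also have "\<dots> \<le> ennreal C"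
    by (intro ennreal_leI nonneg_summable_on_bounded(2) f_nonneg sum_f)
  finally show ?thesis .
qed

text \<open>The singular values of a contraction are at most 1, hence bounded below by their squares,
  whose sum is the square of the Hilbert--Schmidt norm.\<close>

lemma sum_norm_sq_le_trace_norm:
  assumes compact: "L2_compact M T"
    and contraction: "\<And>f. f \<in> L2 M \<Longrightarrow> L2_norm M (T f) \<le> L2_norm M f"
    and C: "\<And>G. finite G \<Longrightarrow> L2_orthonormal M G \<Longrightarrow> (\<Sum>e\<in>G. (L2_norm M (T e))\<^sup>2) \<le> C"
  obtains V where "L2_onb M V"
    "\<And>G. finite G \<Longrightarrow> G \<subseteq> V \<Longrightarrow> ennreal (\<Sum>e\<in>G. (L2_norm M (T e))\<^sup>2) \<le> L2_trace_norm M T"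
proof -
  have bd: "\<exists>N. \<forall>B. finite B \<longrightarrow> B \<subseteq> L2_gram_eigenspace M T (s\<^sup>2) \<longrightarrow> L2_orthonormal M B \<longrightarrow> card B \<le> N"
    if s: "s > 0" for s
  proof (intro exI allI impI)
    fix B assume B: "finite B" "B \<subseteq> L2_gram_eigenspace M T (s\<^sup>2)" "L2_orthonormal M B"
    have "(L2_norm M (T e))\<^sup>2 = s\<^sup>2" if "e \<in> B" for e
      using gram_eigenspace_norm[of e "s\<^sup>2"] B(2) L2_orthonormal_norm[OF B(3) that] that by auto
    then have "real (card B) * s\<^sup>2 \<le> C" using C[OF B(1,3)] by simp
    then have "real (card B) \<le> C / s\<^sup>2" using s by (simp add: field_simps)
    then show "card B \<le> nat \<lfloor>C / s\<^sup>2\<rfloor>" by (simp add: le_nat_floor)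
  qed
  obtain B where B: "\<And>s. s > 0 \<Longrightarrow> finite (B s)"
      "\<And>s. s > 0 \<Longrightarrow> B s \<subseteq> L2_gram_eigenspace M T (s\<^sup>2)"
      "\<And>s. s > 0 \<Longrightarrow> L2_singular_mult M T s = of_nat (card (B s))"
    and max: "\<And>s v. s > 0 \<Longrightarrow> v \<in> L2_gram_eigenspace M T (s\<^sup>2) \<Longrightarrow> L2_norm M v = 1 \<Longrightarrow>
      \<exists>e\<in>B s. L2_inner M v e \<noteq> 0"
    and on: "L2_orthonormal M (\<Union>s\<in>{0<..}. B s)"
    using singular_vectors[OF bd] by metis
  define U where "U = (\<Union>s\<in>{0<..}. B s)"
  obtain V where V: "U \<subseteq> V" "L2_onb M V"
    using L2_orthonormal_extend[OF on] unfolding U_def by blast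
  have onV: "L2_orthonormal M V" using V(2) by (simp add: L2_onb_def)
  have norm_B: "L2_norm M (T e) = s" if "s > 0" "e \<in> B s" for s e
  proof -
    have "(L2_norm M (T e))\<^sup>2 = s\<^sup>2 * (L2_norm M e)\<^sup>2"
      using B(2) that by (intro gram_eigenspace_norm) blast
    also have "L2_norm M e = 1" using that on by (intro L2_orthonormal_norm[of M U]) (auto simp: U_def)
    finally show ?thesis using that(1) L2_norm_nonneg[of M "T e"] by (simp add: power2_eq_iff)
  qed
  \<comment> \<open>Otherwise some unit eigenvector with eigenvalue \<open>c > 0\<close> would be
    orthogonal to all of \<open>U\<close>, in particular to the maximal family
    \<open>B (sqrt c)\<close>.\<close>
  have outside: "L2_norm M (T f) = 0" if f: "f \<in> V" "f \<notin> U" for f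
  proof (rule ccontr)
    assume nz: "L2_norm M (T f) \<noteq> 0"
    have "\<exists>d. e \<in> L2_gram_eigenspace M T d" if "e \<in> U" for e
      using that B(2) by (auto simp: U_def)
    moreover have "L2_inner M f e = 0" if "e \<in> U" for e
      using L2_orthonormalD(2)[OF onV f(1), of e] that f V(1) by auto
    ultimately obtain c v where "c > 0" "v \<in> L2_gram_eigenspace M T c" "L2_norm M v = 1"
        and orth: "\<And>e. e \<in> U \<Longrightarrow> L2_inner M v e = 0"
      using exists_orthogonal_eigenvector[OF compact _ L2_orthonormalD(1)[OF onV f(1)] _ nz] by metis
    then have "\<exists>e\<in>B (sqrt c). L2_inner M v e \<noteq> 0" by (intro max) auto
    moreover have "B (sqrt c) \<subseteq> U" using \<open>c > 0\<close> by (auto simp: U_def intro!: bexI[of _ "sqrt c"])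
    ultimately show False using orth by blast
  qed
  have "ennreal (\<Sum>e\<in>G. (L2_norm M (T e))\<^sup>2) \<le> L2_trace_norm M T" if G: "finite G" "G \<subseteq> V" for G
  proof -
    define \<sigma> where "\<sigma> e = L2_norm M (T e)" for e
    \<comment> \<open>The discarded vectors contribute 0. The others lie in \<open>U\<close> and are
      grouped by their singular value, so that each group can be counted inside
      \<open>B s\<close>.\<close>
    define G' where "G' = {e\<in>G. \<sigma> e \<noteq> 0}"
    have G': "finite G'" "G' \<subseteq> V" using G by (auto simp: G'_def)
    have in_B: "\<sigma> e > 0" "e \<in> B (\<sigma> e)" "\<sigma> e \<le> 1" if "e \<in> G'" for e
    proof -
      have e: "e \<in> V" "e \<in> U" using that G outside by (auto simp: G'_def \<sigma>_def)
      then obtain s where "s > 0" "e \<in> B s" by (auto simp: U_def)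
      then show "\<sigma> e > 0" "e \<in> B (\<sigma> e)" using norm_B by (auto simp: \<sigma>_def)
      show "\<sigma> e \<le> 1"
        using contraction[OF L2_orthonormalD(1)[OF onV e(1)]] L2_orthonormal_norm[OF onV e(1)]
        by (simp add: \<sigma>_def)
    qed
    have "(\<Sum>e\<in>G. (\<sigma> e)\<^sup>2) = (\<Sum>e\<in>G'. (\<sigma> e)\<^sup>2)"
      using G by (intro sum.mono_neutral_right) (auto simp: G'_def)
    also have "\<dots> = (\<Sum>s\<in>\<sigma> ` G'. \<Sum>e\<in>{e\<in>G'. \<sigma> e = s}. (\<sigma> e)\<^sup>2)"
      by (rule sum.image_gen[OF G'(1)])
    also have "\<dots> = (\<Sum>s\<in>\<sigma> ` G'. s\<^sup>2 * real (card {e\<in>G'. \<sigma> e = s}))"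
      by (intro sum.cong) auto
    also have "\<dots> \<le> (\<Sum>s\<in>\<sigma> ` G'. s * real (card (B s)))"
    proof (intro sum_mono mult_mono)
      fix s assume "s \<in> \<sigma> ` G'"
      then obtain e where e: "e \<in> G'" "s = \<sigma> e" by auto
      show "s\<^sup>2 \<le> s" "0 \<le> s"
        using in_B(1,3)[OF e(1)] e(2) mult_left_le[of s s] by (auto simp: power2_eq_square)
      have "{e\<in>G'. \<sigma> e = s} \<subseteq> B s" using in_B by auto
      then show "real (card {e\<in>G'. \<sigma> e = s}) \<le> real (card (B s))"
        using B(1) in_B(1)[OF e(1)] e(2) by (auto intro!: card_mono)
    qed auto
    finally have "ennreal (\<Sum>e\<in>G. (\<sigma> e)\<^sup>2) \<le> ennreal (\<Sum>s\<in>\<sigma> ` G'. s * real (card (B s)))"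
      by (rule ennreal_leI)
    also have "\<dots> = (\<Sum>s\<in>\<sigma> ` G'. ennreal s * L2_singular_mult M T s)"
      using in_B(1) by (subst sum_ennreal[symmetric])
        (auto intro!: sum.cong simp: B(3) ennreal_mult' ennreal_of_nat_eq_real_of_nat less_imp_le)
    also have "\<dots> \<le> (\<integral>\<^sup>+ s. ennreal s * L2_singular_mult M T s \<partial>count_space {0<..})"
      using G'(1) in_B(1) by (intro sum_le_nn_integral_count_space) auto
    also have "\<dots> = L2_trace_norm M T" using compact by (simp add: L2_trace_norm_def)
    finally show ?thesis by (simp add: \<sigma>_def)
  qed
  then show ?thesis using that V(2) by blast
qed

text \<open>Since \<open>A = S T\<close> is positive, \<open>A\<^sup>2 e = s\<^sup>2 e\<close> with \<open>s > 0\<close> forces \<open>A e = s e\<close>, so that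
  \<open>s = \<parallel>T e\<parallel>\<^sup>2\<close> for unit vectors \<open>e\<close>.\<close>

lemma gram_operator_singular_vector:
  assumes s: "s > 0" and e: "e \<in> L2_gram_eigenspace M (\<lambda>f. S (T f)) (s\<^sup>2)" "L2_norm M e = 1"
  shows "(L2_norm M (T e))\<^sup>2 = s"
proof -
  have eL: "e \<in> L2 M" using e(1) by (simp add: L2_gram_eigenspace_def)
  define a where "a = S (T e)"
  define h where "h x = a x - complex_of_real s * e x" for x
  have a: "a \<in> L2 M" unfolding a_def by (intro S_L2 T_L2 eL)
  have se: "(\<lambda>x. complex_of_real s * e x) \<in> L2 M" by (rule L2_scale[OF eL])
  have h: "h \<in> L2 M" unfolding h_def[abs_def] by (intro L2_diff a se)
  have STh: "S (T h) \<in> L2 M" by (intro S_L2 T_L2 h)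
  have inner_h: "L2_inner M h g = L2_inner M a g - complex_of_real s * L2_inner M e g"
    if "g \<in> L2 M" for g
    using L2_inner_diff_left[OF a se that] by (simp add: h_def[abs_def] L2_inner_scale_left)
  \<comment> \<open>Here \<open>h = (A - s) e\<close> with \<open>A = S T\<close>, and
    \<open>(A + s) (A - s) e = 0\<close> says that \<open>A h = - s h\<close>; paired with
    \<open>h\<close>, the left side is nonnegative and the right side nonpositive.\<close>
  have "L2_inner M (T h) (T h) = L2_inner M h (S (T h))"
    by (simp add: inner_ST_right h)
  also have "\<dots> = L2_inner M a (S (T h)) - complex_of_real s * L2_inner M e (S (T h))"
    by (rule inner_h[OF STh])
  also have "L2_inner M a (S (T h)) = complex_of_real (s\<^sup>2) * L2_inner M e h"
    using e(1) h by (simp add: L2_gram_eigenspace_def a_def)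
  also have "L2_inner M e (S (T h)) = L2_inner M a h"
    by (simp add: a_def inner_ST_left inner_ST_right eL h)
  also have "complex_of_real (s\<^sup>2) * L2_inner M e h - complex_of_real s * L2_inner M a h
      = - (complex_of_real s * L2_inner M h h)"
    unfolding inner_h[OF h] by (simp add: power2_eq_square algebra_simps)
  finally have "complex_of_real ((L2_norm M (T h))\<^sup>2) = complex_of_real (- (s * (L2_norm M h)\<^sup>2))"
    by (simp only: L2_inner_self of_real_mult of_real_minus)
  then have "(L2_norm M (T h))\<^sup>2 = - (s * (L2_norm M h)\<^sup>2)" by (simp only: of_real_eq_iff)
  then have "s * (L2_norm M h)\<^sup>2 \<le> 0"
    using zero_le_power2[of "L2_norm M (T h)"] by linarith
  then have "L2_norm M h = 0" using s by (simp add: mult_le_0_iff)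
  then have "L2_inner M h e = 0" using L2_Cauchy_Schwarz[OF h eL] by simp
  then have "L2_inner M a e = complex_of_real s * L2_inner M e e"
    using inner_h[OF eL] by simp
  then have "complex_of_real ((L2_norm M (T e))\<^sup>2) = complex_of_real s"
    by (simp add: a_def inner_ST_left eL L2_inner_self e(2))
  then show ?thesis by (simp only: of_real_eq_iff)
qed

lemma gram_operator_adjoint_pair: "L2_adjoint_pair M (\<lambda>f. S (T f)) (\<lambda>f. S (T f))"
  by unfold_locales (auto simp: L2_is_adjoint_def S_L2 T_L2 inner_ST_left inner_ST_right)

text \<open>The squared norm of \<open>T e\<close> is a weight that reads off the singular values of
  \<open>S T\<close>.\<close>

lemma gram_operator_trace_norm_le:
  assumes "L2_compact M (\<lambda>f. S (T f))"
    and "\<And>G. finite G \<Longrightarrow> L2_orthonormal M G \<Longrightarrow> (\<Sum>e\<in>G. (L2_norm M (T e))\<^sup>2) \<le> C"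
  shows "L2_trace_norm M (\<lambda>f. S (T f)) \<le> ennreal C"
  using L2_adjoint_pair.trace_norm_le[OF gram_operator_adjoint_pair assms(1), of "\<lambda>e. (L2_norm M (T e))\<^sup>2"]
    gram_operator_singular_vector assms(2) by blast

text \<open>\<open>S\<close> inherits the Lipschitz bound of \<open>T\<close>, so it carries the
  convergent images \<open>T (u (r n))\<close> to a convergent sequence.\<close>

lemma gram_operator_compact:
  assumes compact: "L2_compact M T" and op: "L2_operator M (\<lambda>f. S (T f))"
  shows "L2_compact M (\<lambda>f. S (T f))"
  unfolding L2_compact_def
proof (intro conjI allI impI op)
  fix u :: "nat \<Rightarrow> 'a \<Rightarrow> complex"
  assume u: "(\<forall>n. u n \<in> L2 M) \<and> (\<exists>C. \<forall>n. L2_norm M (u n) \<le> C)"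
  obtain C where C: "\<And>f. f \<in> L2 M \<Longrightarrow> L2_norm M (T f) \<le> C * L2_norm M f"
    using compact unfolding L2_compact_def L2_operator_def by blast
  obtain r g where g: "g \<in> L2 M" "strict_mono r"
    and lim: "(\<lambda>n. L2_norm M (\<lambda>x. T (u (r n)) x - g x)) \<longlonglongrightarrow> 0"
    using compact u unfolding L2_compact_def by blast
  have "(\<lambda>n. L2_norm M (\<lambda>x. S (T (u (r n))) x - S g x)) \<longlonglongrightarrow> 0"
  proof (rule Lim_null_comparison)
    show "\<forall>\<^sub>F n in sequentially. norm (L2_norm M (\<lambda>x. S (T (u (r n))) x - S g x))
        \<le> C * L2_norm M (\<lambda>x. T (u (r n)) x - g x)"
      using norm_S_le[OF C T_L2 g(1)] u
      by (intro always_eventually allI) (simp add: L2_norm_nonneg)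
    show "(\<lambda>n. C * L2_norm M (\<lambda>x. T (u (r n)) x - g x)) \<longlonglongrightarrow> 0"
      using tendsto_mult_left[OF lim, of C] by simp
  qed
  then show "\<exists>r. \<exists>g\<in>L2 M. strict_mono r \<and> (\<lambda>n. L2_norm M (\<lambda>x. S (T (u (r n))) x - g x)) \<longlonglongrightarrow> 0"
    using g S_L2 by blast
qed

end

subsection \<open>The truncated Fourier operator\<close>

lemma (in finite_measure) L2_bounded:
  assumes "f \<in> borel_measurable M" "\<And>x. x \<in> space M \<Longrightarrow> cmod (f x) \<le> K"
  shows "f \<in> L2 M" "(L2_norm M f)\<^sup>2 \<le> K\<^sup>2 * measure M (space M)"
proof -
  have [measurable]: "f \<in> borel_measurable M" by fact
  have le: "(cmod (f x))\<^sup>2 \<le> K\<^sup>2" if "x \<in> space M" for x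
    using assms(2)[OF that] by (intro power_mono) auto
  have int: "integrable M (\<lambda>x. (cmod (f x))\<^sup>2)"
    using le by (intro integrable_const_bound[of _ "K\<^sup>2"] AE_I2) auto
  then show "f \<in> L2 M" using assms by (simp add: L2_def)
  have "(LINT x|M. (cmod (f x))\<^sup>2) \<le> (LINT x|M. K\<^sup>2)"
    using le by (intro integral_mono int) auto
  then show "(L2_norm M f)\<^sup>2 \<le> K\<^sup>2 * measure M (space M)"
    by (simp add: L2_norm_sq mult.commute)
qed

lemma (in finite_measure) L2_dominated_convergence:
  assumes [measurable]: "\<And>n. f n \<in> borel_measurable M" "g \<in> borel_measurable M"
    and bd: "\<And>n x. cmod (f n x) \<le> K"
    and lim: "\<And>x. (\<lambda>n. f n x) \<longlonglongrightarrow> g x"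
  shows "(\<lambda>n. L2_norm M (\<lambda>x. f n x - g x)) \<longlonglongrightarrow> 0"
proof -
  have gK: "cmod (g x) \<le> K" for x
    using tendsto_norm[OF lim[of x]] by (rule LIMSEQ_le_const2) (use bd in auto)
  have bd2: "(cmod (f n x - g x))\<^sup>2 \<le> (2 * K)\<^sup>2" for n x
    using bd[of n x] gK[of x] norm_triangle_ineq4[of "f n x" "g x"] by (intro power_mono) simp_all
  have "(\<lambda>n. LINT x|M. (cmod (f n x - g x))\<^sup>2) \<longlonglongrightarrow> (LINT x|M. 0)"
  proof (rule integral_dominated_convergence)
    show "integrable M (\<lambda>x. (2 * K)\<^sup>2)" by simp
    show "AE x in M. (\<lambda>n. (cmod (f n x - g x))\<^sup>2) \<longlonglongrightarrow> 0"
    proof (rule AE_I2)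
      fix x
      have "(\<lambda>n. (cmod (f n x - g x))\<^sup>2) \<longlonglongrightarrow> (cmod (g x - g x))\<^sup>2"
        by (intro tendsto_intros lim)
      then show "(\<lambda>n. (cmod (f n x - g x))\<^sup>2) \<longlonglongrightarrow> 0" by simp
    qed
    show "AE x in M. norm ((cmod (f n x - g x))\<^sup>2) \<le> (2 * K)\<^sup>2" for n
      using bd2 by (intro AE_I2) simp
  qed measurable
  then show ?thesis
    using tendsto_real_sqrt by (fastforce simp: L2_norm_def)
qed

section \<open>Pointwise bounds, continuity and compactness of the truncated Fourier
  operator\<close>

definition fourier_vector :: "real \<Rightarrow> real \<Rightarrow> complex" where
  "fourier_vector t \<xi> = exp (- (\<i> * t * \<xi>)) / sqrt (2 * pi)"

lemma norm_fourier_vector: "cmod (fourier_vector t \<xi>) = 1 / sqrt (2 * pi)"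
  by (simp add: fourier_vector_def norm_divide)

locale finite_lebesgue_set =
  fixes E :: "real set"
  assumes E: "E \<in> sets lebesgue" and finite_E: "emeasure lebesgue E < \<infinity>"
begin

abbreviation "M \<equiv> lebesgue_on E"
abbreviation "F \<equiv> truncated_fourier E"
abbreviation "m \<equiv> measure lebesgue E"

sublocale finite_measure M
  using E finite_E by (auto intro!: finite_measureI simp: emeasure_restrict_space)

lemma measure_space_M: "measure M (space M) = m"
  using E by (simp add: measure_restrict_space)

lemma borel_measurable_M: "f \<in> borel_measurable borel \<Longrightarrow> f \<in> borel_measurable M"
  by (intro measurable_restrict_space1 measurable_completion) simp

lemma continuous_measurable_M:
  fixes f :: "real \<Rightarrow> 'b::topological_space"
  shows "continuous_on UNIV f \<Longrightarrow> f \<in> borel_measurable M"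
  by (intro borel_measurable_M borel_measurable_continuous_onI)

lemma fourier_vector_measurable: "fourier_vector t \<in> borel_measurable M"
  unfolding fourier_vector_def[abs_def] by (intro continuous_measurable_M continuous_intros) auto

lemma fourier_vector_L2: "fourier_vector t \<in> L2 M"
  by (rule L2_bounded(1)[OF fourier_vector_measurable, of _ "1 / sqrt (2 * pi)"])
    (simp add: norm_fourier_vector)

lemma fourier_vector_norm: "(L2_norm M (fourier_vector t))\<^sup>2 = m / (2 * pi)"
  unfolding L2_norm_sq by (simp add: norm_fourier_vector power_divide measure_space_M[simplified])

lemma F_eq_inner: "F x t = L2_inner M x (fourier_vector t)"
proof -
  have "F x t = (LINT \<xi>|M. 1 / sqrt (2 * pi) * (exp (\<i> * t * \<xi>) * x \<xi>))"
    by (simp add: truncated_fourier_def)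
  also have "\<dots> = L2_inner M x (fourier_vector t)"
    unfolding L2_inner_def fourier_vector_def
    by (intro Bochner_Integration.integral_cong) (simp_all add: exp_cnj)
  finally show ?thesis .
qed

lemma adj_eq: "truncated_fourier_adj E x t = F x (- t)"
  by (simp add: truncated_fourier_def truncated_fourier_adj_def)

lemma fourier_vector_tendsto:
  assumes "s \<longlonglongrightarrow> t"
  shows "(\<lambda>n. L2_norm M (\<lambda>\<xi>. fourier_vector (s n) \<xi> - fourier_vector t \<xi>)) \<longlonglongrightarrow> 0"
proof (rule L2_dominated_convergence[OF fourier_vector_measurable fourier_vector_measurable])
  show "cmod (fourier_vector (s n) \<xi>) \<le> 1 / sqrt (2 * pi)" for n \<xi>
    by (simp add: norm_fourier_vector)
  show "(\<lambda>n. fourier_vector (s n) \<xi>) \<longlonglongrightarrow> fourier_vector t \<xi>" for \<xi>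
    unfolding fourier_vector_def by (intro tendsto_intros assms) auto
qed

text \<open>The vectors \<open>fourier_vector t\<close> depend continuously on \<open>t\<close> in
  norm. Hence \<open>F x\<close> is continuous on the whole line and determined by its values at
  rational points.\<close>

lemma F_continuous:
  assumes x: "x \<in> L2 M"
  shows "continuous_on UNIV (F x)"
proof (rule continuous_on_sequentiallyI)
  fix s :: "nat \<Rightarrow> real" and t assume "s \<longlonglongrightarrow> t"
  then have "(\<lambda>n. cnj (L2_inner M (fourier_vector (s n)) x)) \<longlonglongrightarrow> cnj (L2_inner M (fourier_vector t) x)"
    by (intro tendsto_cnj L2_tendsto_inner fourier_vector_L2 x fourier_vector_tendsto)
  then show "(\<lambda>n. F x (s n)) \<longlonglongrightarrow> F x t"
    by (simp only: F_eq_inner L2_inner_cnj[symmetric])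
qed

lemma F_bound:
  assumes x: "x \<in> L2 M"
  shows "cmod (F x t) \<le> sqrt (m / (2 * pi)) * L2_norm M x"
proof -
  have "L2_norm M (fourier_vector t) = sqrt (m / (2 * pi))"
    using fourier_vector_norm[of t] L2_norm_nonneg[of M "fourier_vector t"] real_sqrt_unique by metis
  then show ?thesis
    using L2_Cauchy_Schwarz[OF x fourier_vector_L2, of t] by (simp add: F_eq_inner mult.commute)
qed

lemma F_measurable: "x \<in> L2 M \<Longrightarrow> F x \<in> borel_measurable M"
  by (intro continuous_measurable_M F_continuous)

lemma F_L2: "x \<in> L2 M \<Longrightarrow> F x \<in> L2 M"
  by (rule L2_bounded(1)[OF F_measurable F_bound])

lemma F_norm_le:
  assumes x: "x \<in> L2 M"
  shows "L2_norm M (F x) \<le> m / sqrt (2 * pi) * L2_norm M x"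
proof (rule power2_le_imp_le)
  have "(L2_norm M (F x))\<^sup>2 \<le> (sqrt (m / (2 * pi)) * L2_norm M x)\<^sup>2 * m"
    using L2_bounded(2)[OF F_measurable[OF x] F_bound[OF x]] by (simp only: measure_space_M)
  also have "\<dots> = (m / sqrt (2 * pi) * L2_norm M x)\<^sup>2"
    by (simp add: power_mult_distrib power_divide power2_eq_square[of m])
  finally show "(L2_norm M (F x))\<^sup>2 \<le> (m / sqrt (2 * pi) * L2_norm M x)\<^sup>2" .
qed (simp add: L2_norm_nonneg)

sublocale L2_adjoint_pair M F "truncated_fourier_adj E"
  using truncated_fourier_adjoint[OF E finite_E] F_L2 by unfold_locales

lemma F_operator: "L2_operator M F"
  unfolding L2_operator_def
proof (intro conjI ballI allI)
  show "\<exists>C. \<forall>f\<in>L2 M. L2_norm M (F f) \<le> C * L2_norm M f" using F_norm_le by blast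
qed (simp_all add: F_L2 F_eq_inner L2_inner_add_left fourier_vector_L2 L2_inner_scale_left)

lemma F_compact: "L2_compact M F"
  unfolding L2_compact_def
proof (intro conjI allI impI F_operator)
  fix u :: "nat \<Rightarrow> real \<Rightarrow> complex"
  assume "(\<forall>n. u n \<in> L2 M) \<and> (\<exists>C. \<forall>n. L2_norm M (u n) \<le> C)"
  then obtain C where u: "\<And>n. u n \<in> L2 M" and C: "\<And>n. L2_norm M (u n) \<le> C" by blast
  have C0: "0 \<le> C" using C[of 0] L2_norm_nonneg[of M "u 0"] by linarith
  define K where "K = sqrt (m / (2 * pi)) * C"
  have K: "cmod (F (u n) t) \<le> K" for n t
    using F_bound[OF u, of n t] mult_left_mono[OF C[of n], of "sqrt (m / (2 * pi))"]
    by (simp add: K_def)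
  \<comment> \<open>A diagonal argument over the countable set of rationals, with the values bounded
    by \<open>K\<close>.\<close>
  obtain r where r: "strict_mono r" and conv_Rats: "\<And>q. q \<in> \<rat> \<Longrightarrow> \<exists>l. (\<lambda>n. F (u (r n)) q) \<longlonglongrightarrow> l"
    using function_convergent_subsequence[of "\<rat> :: real set" "\<lambda>n. F (u n)" K] K countable_rat by blast
  have "convergent (\<lambda>n. F (u (r n)) t)" for t
  proof -
    have "Cauchy (\<lambda>n. F (u (r n)) t)"
    proof (rule metric_CauchyI)
      fix e :: real assume e: "e > 0"
      \<comment> \<open>A modulus of continuity at \<open>t\<close> common to all
        \<open>F (u n)\<close>: the sequence enters through its norm bound \<open>C\<close>
        alone.\<close>
      define \<delta> where "\<delta> q = C * L2_norm M (\<lambda>\<xi>. fourier_vector q \<xi> - fourier_vector t \<xi>)" for q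
      have diff: "cmod (F (u n) q - F (u n) t) \<le> \<delta> q" for n q
      proof -
        have "cmod (F (u n) q - F (u n) t) = cmod (L2_inner M (u n) (\<lambda>\<xi>. fourier_vector q \<xi> - fourier_vector t \<xi>))"
          by (simp add: F_eq_inner L2_inner_diff_right fourier_vector_L2 u)
        also have "\<dots> \<le> L2_norm M (u n) * L2_norm M (\<lambda>\<xi>. fourier_vector q \<xi> - fourier_vector t \<xi>)"
          by (intro L2_Cauchy_Schwarz L2_diff fourier_vector_L2 u)
        also have "\<dots> \<le> \<delta> q" unfolding \<delta>_def by (intro mult_right_mono C L2_norm_nonneg)
        finally show ?thesis .
      qed
      have "t \<in> closure \<rat>" by (simp add: Rats_closure_real)
      then obtain p where p: "\<And>n. p n \<in> \<rat>" "p \<longlonglongrightarrow> t"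
        unfolding closure_sequential by blast
      have "(\<lambda>n. \<delta> (p n)) \<longlonglongrightarrow> C * 0"
        unfolding \<delta>_def by (intro tendsto_mult tendsto_const fourier_vector_tendsto p)
      then have "\<forall>\<^sub>F n in sequentially. \<delta> (p n) < e / 3"
        using e by (intro order_tendstoD) auto
      then obtain k where k: "\<delta> (p k) < e / 3" by (auto simp: eventually_sequentially)
      have "Cauchy (\<lambda>n. F (u (r n)) (p k))"
        using conv_Rats[OF p(1)] LIMSEQ_imp_Cauchy by blast
      then obtain N where N: "\<And>i j. i \<ge> N \<Longrightarrow> j \<ge> N \<Longrightarrow> dist (F (u (r i)) (p k)) (F (u (r j)) (p k)) < e / 3"
        using e unfolding Cauchy_def by (metis divide_pos_pos zero_less_numeral)
      have "dist (F (u (r i)) t) (F (u (r j)) t) < e" if "i \<ge> N" "j \<ge> N" for i j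
      proof -
        have "dist (F (u (r i)) t) (F (u (r j)) t) \<le> dist (F (u (r i)) t) (F (u (r i)) (p k))
            + dist (F (u (r i)) (p k)) (F (u (r j)) (p k)) + dist (F (u (r j)) (p k)) (F (u (r j)) t)"
          using dist_triangle[of "F (u (r i)) t" "F (u (r j)) t" "F (u (r i)) (p k)"]
            dist_triangle[of "F (u (r i)) (p k)" "F (u (r j)) t" "F (u (r j)) (p k)"] by linarith
        moreover have "dist (F (u (r i)) t) (F (u (r i)) (p k)) \<le> \<delta> (p k)"
          using diff[of "r i" "p k"] by (simp add: dist_norm norm_minus_commute)
        moreover have "dist (F (u (r j)) (p k)) (F (u (r j)) t) \<le> \<delta> (p k)"
          using diff[of "r j" "p k"] by (simp add: dist_norm)
        ultimately show ?thesis using N[OF that] k by linarith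
      qed
      then show "\<exists>N. \<forall>i\<ge>N. \<forall>j\<ge>N. dist (F (u (r i)) t) (F (u (r j)) t) < e" by blast
    qed
    then show ?thesis by (simp add: Cauchy_convergent)
  qed
  then obtain g where g: "\<And>t. (\<lambda>n. F (u (r n)) t) \<longlonglongrightarrow> g t"
    unfolding convergent_def by metis
  have gm: "g \<in> borel_measurable M"
    using F_measurable[OF u] g by (rule borel_measurable_LIMSEQ_metric)
  have "cmod (g t) \<le> K" for t
    using tendsto_norm[OF g[of t]] by (rule LIMSEQ_le_const2) (use K in auto)
  then have "g \<in> L2 M" by (rule L2_bounded(1)[OF gm])
  moreover have "(\<lambda>n. L2_norm M (\<lambda>t. F (u (r n)) t - g t)) \<longlonglongrightarrow> 0"
    by (rule L2_dominated_convergence[OF F_measurable[OF u] gm K g])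
  ultimately show "\<exists>r. \<exists>g\<in>L2 M. strict_mono r \<and> (\<lambda>n. L2_norm M (\<lambda>t. F (u (r n)) t - g t)) \<longlonglongrightarrow> 0"
    using r by blast
qed

lemma FF_operator: "L2_operator M (\<lambda>f. truncated_fourier_adj E (F f))"
  unfolding L2_operator_def
proof (intro conjI ballI allI)
  let ?A = "\<lambda>f. truncated_fourier_adj E (F f)"
  have F_add: "F (\<lambda>y. f y + g y) = (\<lambda>y. F f y + F g y)" if "f \<in> L2 M" "g \<in> L2 M" for f g
    using that by (simp add: fun_eq_iff F_eq_inner L2_inner_add_left fourier_vector_L2)
  have F_scale: "F (\<lambda>y. c * f y) = (\<lambda>y. c * F f y)" for c f
    by (simp add: fun_eq_iff F_eq_inner L2_inner_scale_left)
  show "?A f \<in> L2 M" if "f \<in> L2 M" for f by (intro S_L2 F_L2 that)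
  show "AE x in M. ?A (\<lambda>y. f y + g y) x = ?A f x + ?A g x" if "f \<in> L2 M" "g \<in> L2 M" for f g
    using F_add[OF that] F_add[OF F_L2[OF that(1)] F_L2[OF that(2)]] by (simp add: adj_eq)
  show "AE x in M. ?A (\<lambda>y. c * f y) x = c * ?A f x" for c f
    by (simp add: adj_eq F_scale)
  show "\<exists>C. \<forall>f\<in>L2 M. L2_norm M (?A f) \<le> C * L2_norm M f"
  proof (intro exI ballI)
    fix f assume f: "f \<in> L2 M"
    \<comment> \<open>Comparison with the zero vector turns the estimate for differences into a norm
      bound.\<close>
    have "truncated_fourier_adj E (\<lambda>x. 0) = (\<lambda>x. 0)"
      by (simp add: fun_eq_iff truncated_fourier_adj_def)
    then have "L2_norm M (?A f) \<le> m / sqrt (2 * pi) * L2_norm M (F f)"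
      using norm_S_le[OF F_norm_le F_L2[OF f] L2_zero] by simp
    also have "\<dots> \<le> m / sqrt (2 * pi) * (m / sqrt (2 * pi) * L2_norm M f)"
      by (intro mult_left_mono F_norm_le f) simp
    finally show "L2_norm M (?A f) \<le> (m / sqrt (2 * pi) * (m / sqrt (2 * pi))) * L2_norm M f"
      by (simp only: mult.assoc)
  qed
qed

section \<open>Squared norms summed over orthonormal families and bases\<close>

lemma cmod_F_sq: "(cmod (F e t))\<^sup>2 = (cmod (L2_inner M (fourier_vector t) e))\<^sup>2"
  using L2_inner_cnj[of M e "fourier_vector t"] by (simp add: F_eq_inner)

lemma sum_norm_F_sq_le:
  assumes G: "finite G" "L2_orthonormal M G"
  shows "(\<Sum>e\<in>G. (L2_norm M (F e))\<^sup>2) \<le> m\<^sup>2 / (2 * pi)"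
proof -
  have int: "integrable M (\<lambda>t. (cmod (F e t))\<^sup>2)" if "e \<in> G" for e
    using F_L2[OF L2_orthonormalD(1)[OF G(2) that]] by (simp add: L2_def)
  have "(\<Sum>e\<in>G. (L2_norm M (F e))\<^sup>2) = (LINT t|M. (\<Sum>e\<in>G. (cmod (F e t))\<^sup>2))"
    unfolding L2_norm_sq using int by (rule Bochner_Integration.integral_sum[symmetric])
  also have "\<dots> \<le> (LINT t|M. m / (2 * pi))"
  proof (rule integral_mono)
    show "integrable M (\<lambda>t. \<Sum>e\<in>G. (cmod (F e t))\<^sup>2)" by (intro Bochner_Integration.integrable_sum int)
    show "(\<Sum>e\<in>G. (cmod (F e t))\<^sup>2) \<le> m / (2 * pi)" for t
      using L2_Bessel[OF G(2,1) order_refl fourier_vector_L2[of t]]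
      by (simp only: cmod_F_sq fourier_vector_norm)
  qed simp
  also have "\<dots> = m\<^sup>2 / (2 * pi)"
    using measure_space_M by (simp add: power2_eq_square)
  finally show ?thesis .
qed

text \<open>Only countably many elements of an orthonormal basis have a Fourier transform that does not
  vanish on the rationals; by continuity the others do not contribute. This makes Tonelli's
  theorem applicable without separability of the space.\<close>

lemma has_sum_norm_F_sq:
  assumes V: "L2_onb M V"
  shows "((\<lambda>e. (L2_norm M (F e))\<^sup>2) has_sum (m\<^sup>2 / (2 * pi))) V"
proof -
  let ?f = "\<lambda>e. (L2_norm M (F e))\<^sup>2"
  have on: "L2_orthonormal M V" using V by (simp add: L2_onb_def)
  have VL: "e \<in> L2 M" if "e \<in> V" for e using L2_orthonormalD(1)[OF on that] .
  have sum: "?f summable_on V"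
    using L2_orthonormal_subset[OF on]
    by (intro nonneg_summable_on_bounded(1)[of _ _ "m\<^sup>2 / (2 * pi)"] sum_norm_F_sq_le) auto
  have Parseval: "((\<lambda>e. (cmod (F e t))\<^sup>2) has_sum (m / (2 * pi))) V" for t
    using L2_Parseval[OF V fourier_vector_L2[of t]] by (simp only: cmod_F_sq fourier_vector_norm)
  define W where "W = {e\<in>V. \<exists>q\<in>\<rat>. F e q \<noteq> 0}"
  have WV: "W \<subseteq> V" by (auto simp: W_def)
  \<comment> \<open>By Parseval's identity the coefficients at each rational \<open>q\<close> are
    summable, so only countably many are nonzero.\<close>
  have "countable (\<Union>q\<in>\<rat>. {e\<in>V. (cmod (F e q))\<^sup>2 \<noteq> 0})"
    using Parseval by (intro countable_UN countable_rat summable_countable_real) (auto simp: summable_on_def)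
  then have W: "countable W"
    by (rule countable_subset[rotated]) (auto simp: W_def)
  have zero: "F e t = 0" if e: "e \<in> V" "e \<notin> W" for e t
  proof -
    have "continuous_on (closure \<rat>) (F e)" using F_continuous[OF VL[OF e(1)]] by (simp add: Rats_closure_real)
    moreover have "F e q = 0" if "q \<in> \<rat>" for q using e that by (auto simp: W_def)
    moreover have "t \<in> closure \<rat>" by (simp add: Rats_closure_real)
    ultimately show ?thesis by (rule continuous_constant_on_closure)
  qed
  have "infsum ?f V = infsum ?f W"
    using WV zero by (intro infsum_cong_neutral) (auto simp: L2_norm_def)
  then have "ennreal (infsum ?f V) = ennreal (infsum ?f W)" by simp
  also have "\<dots> = (\<integral>\<^sup>+ e. ennreal (?f e) \<partial>count_space W)"
    using sum WV by (intro nn_integral_count_space_infsum[symmetric]) (auto intro: summable_on_subset_banach)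
  also have "\<dots> = (\<integral>\<^sup>+ e. \<integral>\<^sup>+ t. ennreal ((cmod (F e t))\<^sup>2) \<partial>M \<partial>count_space W)"
    using WV by (intro nn_integral_cong) (auto simp: L2_nn_integral_sq F_L2 VL subset_iff)
  also have "\<dots> = (\<integral>\<^sup>+ t. \<integral>\<^sup>+ e. ennreal ((cmod (F e t))\<^sup>2) \<partial>count_space W \<partial>M)"
  proof (rule nn_integral_count_space_nn_integral[OF W, symmetric])
    fix e assume "e \<in> W"
    then have [measurable]: "F e \<in> borel_measurable M" using WV by (intro F_measurable VL) auto
    show "(\<lambda>t. ennreal ((cmod (F e t))\<^sup>2)) \<in> borel_measurable M" by measurable
  qed
  also have "\<dots> = (\<integral>\<^sup>+ t. ennreal (m / (2 * pi)) \<partial>M)"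
  proof (rule nn_integral_cong)
    fix t
    have "((\<lambda>e. (cmod (F e t))\<^sup>2) has_sum (m / (2 * pi))) W"
      using Parseval[of t] WV zero by (subst has_sum_cong_neutral[of V W]) auto
    then have "(\<lambda>e. (cmod (F e t))\<^sup>2) summable_on W" "infsum (\<lambda>e. (cmod (F e t))\<^sup>2) W = m / (2 * pi)"
      by (auto simp: summable_on_def infsumI)
    then show "(\<integral>\<^sup>+ e. ennreal ((cmod (F e t))\<^sup>2) \<partial>count_space W) = ennreal (m / (2 * pi))"
      using nn_integral_count_space_infsum[of "\<lambda>e. (cmod (F e t))\<^sup>2" W] by simp
  qed
  also have "\<dots> = ennreal (m / (2 * pi)) * ennreal m"
    using measure_space_M by (simp add: emeasure_eq_measure)
  also have "\<dots> = ennreal (m\<^sup>2 / (2 * pi))"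
    by (simp add: ennreal_mult'[symmetric] power2_eq_square)
  finally have "infsum ?f V = m\<^sup>2 / (2 * pi)"
    by (simp add: infsum_nonneg)
  then show ?thesis using has_sum_infsum[OF sum] by simp
qed

end

subsection \<open>Contractivity and the integral kernel\<close>

text \<open>Up to the factor \<open>sqrt (2 * pi) / \<sigma>\<close> the integrand is the normal
  density with mean \<open>x\<close> and standard deviation \<open>1 / \<sigma>\<close>.\<close>

lemma nn_integral_gaussian:
  assumes "\<sigma> > 0"
  shows "(\<integral>\<^sup>+ y. ennreal (exp (- (\<sigma> * (x - y))\<^sup>2 / 2)) \<partial>lborel) = ennreal (sqrt (2 * pi) / \<sigma>)"
proof -
  have eq: "exp (- (\<sigma> * (x - y))\<^sup>2 / 2) = sqrt (2 * pi) / \<sigma> * normal_density x (1 / \<sigma>) y" for y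
  proof -
    have "- (\<sigma> * (x - y))\<^sup>2 / 2 = - (y - x)\<^sup>2 / (2 * (1 / \<sigma>)\<^sup>2)"
      by (simp only: power_mult_distrib power2_commute[of x y] power_divide) simp
    moreover have "sqrt (2 * pi * (1 / \<sigma>)\<^sup>2) = sqrt (2 * pi) / \<sigma>"
      using assms by (simp add: real_sqrt_mult)
    ultimately show ?thesis using assms by (simp add: normal_density_def)
  qed
  have "(\<integral>\<^sup>+ y. ennreal (exp (- (\<sigma> * (x - y))\<^sup>2 / 2)) \<partial>lborel)
      = (\<integral>\<^sup>+ y. ennreal (sqrt (2 * pi) / \<sigma>) * ennreal (normal_density x (1 / \<sigma>) y) \<partial>lborel)"
    unfolding eq using assms by (intro nn_integral_cong ennreal_mult') simp
  also have "\<dots> = ennreal (sqrt (2 * pi) / \<sigma>) * (\<integral>\<^sup>+ y. ennreal (normal_density x (1 / \<sigma>) y) \<partial>lborel)"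
    by (rule nn_integral_cmult) measurable
  also have "(\<integral>\<^sup>+ y. ennreal (normal_density x (1 / \<sigma>) y) \<partial>lborel) = 1"
    using assms by (subst nn_integral_eq_integral) auto
  finally show ?thesis by simp
qed

context finite_lebesgue_set
begin

section \<open>Gaussian means of squared Fourier transforms\<close>

lemma nn_integral_M_le:
  assumes "f \<in> borel_measurable borel"
  shows "(\<integral>\<^sup>+ t. f t \<partial>M) \<le> (\<integral>\<^sup>+ t. f t \<partial>lborel)"
proof -
  have "(\<integral>\<^sup>+ t. f t \<partial>M) = (\<integral>\<^sup>+ t. f t * indicator E t \<partial>lebesgue)"
    using E by (subst nn_integral_restrict_space) simp_all
  also have "\<dots> \<le> (\<integral>\<^sup>+ t. f t \<partial>lebesgue)"
    by (intro nn_integral_mono) (auto split: split_indicator)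
  also have "\<dots> = (\<integral>\<^sup>+ t. f t \<partial>lborel)"
    using assms by (simp add: nn_integral_completion)
  finally show ?thesis .
qed

lemma difference_measurable: "(\<lambda>z. fst z - snd z) \<in> borel_measurable (M \<Otimes>\<^sub>M M)"
proof -
  have "(\<lambda>t. t) \<in> borel_measurable M" by (rule borel_measurable_M) simp
  then show ?thesis
    by (intro borel_measurable_diff measurable_compose[OF measurable_fst] measurable_compose[OF measurable_snd])
qed

text \<open>Schur's test for the Gaussian kernel.\<close>

lemma gaussian_form_le:
  assumes x: "x \<in> L2 M" and \<sigma>: "\<sigma> > 0"
  shows "(\<integral>\<^sup>+ z. ennreal (cmod (x (fst z)) * cmod (x (snd z)) * exp (- (\<sigma> * (fst z - snd z))\<^sup>2 / 2)) \<partial>(M \<Otimes>\<^sub>M M))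
    \<le> ennreal (sqrt (2 * pi) / \<sigma> * (L2_norm M x)\<^sup>2)"
proof -
  interpret P: pair_sigma_finite M M by unfold_locales
  define g where "g z = exp (- (\<sigma> * (fst z - snd z))\<^sup>2 / 2)" for z :: "real \<times> real"
  have [measurable]: "g \<in> borel_measurable (M \<Otimes>\<^sub>M M)"
    using difference_measurable unfolding g_def[abs_def] by measurable
  have [measurable]: "(\<lambda>\<eta>. g (\<xi>, \<eta>)) \<in> borel_measurable M" "(\<lambda>\<eta>. g (\<eta>, \<xi>)) \<in> borel_measurable M" for \<xi>
    unfolding g_def by (intro continuous_measurable_M continuous_intros; simp)+
  have [measurable]: "x \<in> borel_measurable M" by (rule L2_measurable[OF x])
  define c where "c = sqrt (2 * pi) / \<sigma>"
  have c: "c > 0" using \<sigma> by (simp add: c_def)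
  have g_int: "(\<integral>\<^sup>+ \<eta>. ennreal (g (\<xi>, \<eta>)) \<partial>M) \<le> ennreal c" "(\<integral>\<^sup>+ \<eta>. ennreal (g (\<eta>, \<xi>)) \<partial>M) \<le> ennreal c" for \<xi>
  proof -
    have "(\<integral>\<^sup>+ \<eta>. ennreal (exp (- (\<sigma> * (\<xi> - \<eta>))\<^sup>2 / 2)) \<partial>M) \<le> (\<integral>\<^sup>+ \<eta>. ennreal (exp (- (\<sigma> * (\<xi> - \<eta>))\<^sup>2 / 2)) \<partial>lborel)"
      by (rule nn_integral_M_le) measurable
    also have "\<dots> = ennreal c" unfolding c_def by (rule nn_integral_gaussian[OF \<sigma>])
    finally show "(\<integral>\<^sup>+ \<eta>. ennreal (g (\<xi>, \<eta>)) \<partial>M) \<le> ennreal c" by (simp add: g_def)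
    then show "(\<integral>\<^sup>+ \<eta>. ennreal (g (\<eta>, \<xi>)) \<partial>M) \<le> ennreal c"
      by (simp add: g_def power_mult_distrib power2_commute[of _ \<xi>])
  qed
  have half: "(\<integral>\<^sup>+ \<xi>. ennreal ((cmod (x \<xi>))\<^sup>2 / 2) * h \<xi> \<partial>M) \<le> ennreal (c * (L2_norm M x)\<^sup>2 / 2)"
    if h: "\<And>\<xi>. h \<xi> \<le> ennreal c" for h
  proof -
    have "(\<integral>\<^sup>+ \<xi>. ennreal ((cmod (x \<xi>))\<^sup>2 / 2) * h \<xi> \<partial>M) \<le> (\<integral>\<^sup>+ \<xi>. ennreal (c / 2) * ennreal ((cmod (x \<xi>))\<^sup>2) \<partial>M)"
    proof (rule nn_integral_mono)
      fix \<xi>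
      have "ennreal ((cmod (x \<xi>))\<^sup>2 / 2) * h \<xi> \<le> ennreal ((cmod (x \<xi>))\<^sup>2 / 2) * ennreal c"
        by (intro mult_left_mono h) simp
      also have "\<dots> = ennreal (c / 2) * ennreal ((cmod (x \<xi>))\<^sup>2)"
        using c by (simp add: ennreal_mult'[symmetric] mult.commute)
      finally show "ennreal ((cmod (x \<xi>))\<^sup>2 / 2) * h \<xi> \<le> ennreal (c / 2) * ennreal ((cmod (x \<xi>))\<^sup>2)" .
    qed
    also have "\<dots> = ennreal (c / 2) * ennreal ((L2_norm M x)\<^sup>2)"
      by (simp add: nn_integral_cmult L2_nn_integral_sq[OF x])
    also have "\<dots> = ennreal (c * (L2_norm M x)\<^sup>2 / 2)"
      using c by (simp add: ennreal_mult'[symmetric])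
    finally show ?thesis .
  qed
  \<comment> \<open>By \<open>2ab \<le> a^2 + b^2\<close> each summand depends on \<open>x\<close>
    in one coordinate only; the other coordinate is integrated out first, which leaves at most the
    Gaussian mass \<open>c\<close>.\<close>
  have "(\<integral>\<^sup>+ z. ennreal (cmod (x (fst z)) * cmod (x (snd z)) * g z) \<partial>(M \<Otimes>\<^sub>M M))
      \<le> (\<integral>\<^sup>+ z. ennreal ((cmod (x (fst z)))\<^sup>2 / 2) * ennreal (g z) + ennreal ((cmod (x (snd z)))\<^sup>2 / 2) * ennreal (g z) \<partial>(M \<Otimes>\<^sub>M M))"
  proof (rule nn_integral_mono)
    fix z
    have "cmod (x (fst z)) * cmod (x (snd z)) \<le> (cmod (x (fst z)))\<^sup>2 / 2 + (cmod (x (snd z)))\<^sup>2 / 2"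
      using sum_squares_bound[of "cmod (x (fst z))" "cmod (x (snd z))"] by simp
    then have "cmod (x (fst z)) * cmod (x (snd z)) * g z \<le> ((cmod (x (fst z)))\<^sup>2 / 2 + (cmod (x (snd z)))\<^sup>2 / 2) * g z"
      by (rule mult_right_mono) (simp add: g_def)
    then show "ennreal (cmod (x (fst z)) * cmod (x (snd z)) * g z)
        \<le> ennreal ((cmod (x (fst z)))\<^sup>2 / 2) * ennreal (g z) + ennreal ((cmod (x (snd z)))\<^sup>2 / 2) * ennreal (g z)"
      by (simp add: ennreal_mult'[symmetric] ennreal_plus[symmetric] distrib_right g_def ennreal_leI del: ennreal_plus)
  qed
  also have "\<dots> = (\<integral>\<^sup>+ z. ennreal ((cmod (x (fst z)))\<^sup>2 / 2) * ennreal (g z) \<partial>(M \<Otimes>\<^sub>M M))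
      + (\<integral>\<^sup>+ z. ennreal ((cmod (x (snd z)))\<^sup>2 / 2) * ennreal (g z) \<partial>(M \<Otimes>\<^sub>M M))"
    by (rule nn_integral_add) measurable
  also have "(\<integral>\<^sup>+ z. ennreal ((cmod (x (fst z)))\<^sup>2 / 2) * ennreal (g z) \<partial>(M \<Otimes>\<^sub>M M))
      = (\<integral>\<^sup>+ \<xi>. ennreal ((cmod (x \<xi>))\<^sup>2 / 2) * (\<integral>\<^sup>+ \<eta>. ennreal (g (\<xi>, \<eta>)) \<partial>M) \<partial>M)"
    by (subst nn_integral_fst[symmetric]) (simp_all add: nn_integral_cmult)
  also have "\<dots> \<le> ennreal (c * (L2_norm M x)\<^sup>2 / 2)" by (rule half) (rule g_int)
  also have "(\<integral>\<^sup>+ z. ennreal ((cmod (x (snd z)))\<^sup>2 / 2) * ennreal (g z) \<partial>(M \<Otimes>\<^sub>M M))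
      = (\<integral>\<^sup>+ \<xi>. ennreal ((cmod (x \<xi>))\<^sup>2 / 2) * (\<integral>\<^sup>+ \<eta>. ennreal (g (\<eta>, \<xi>)) \<partial>M) \<partial>M)"
    by (subst P.nn_integral_snd[symmetric]) (simp_all add: nn_integral_cmult)
  also have "\<dots> \<le> ennreal (c * (L2_norm M x)\<^sup>2 / 2)" by (rule half) (rule g_int)
  also have "ennreal (c * (L2_norm M x)\<^sup>2 / 2) + ennreal (c * (L2_norm M x)\<^sup>2 / 2) = ennreal (c * (L2_norm M x)\<^sup>2)"
    using c by (simp add: ennreal_plus[symmetric] del: ennreal_plus)
  finally show ?thesis by (simp add: g_def c_def add_mono)
qed

text \<open>As a double integral, the squared modulus depends on \<open>\<tau>\<close> only through
  a character evaluated at the difference of the coordinates, so averaging over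
  \<open>\<tau>\<close> acts on that factor alone.\<close>

lemma F_norm_sq_eq:
  assumes x: "x \<in> L2 M"
  shows "integrable (M \<Otimes>\<^sub>M M) (\<lambda>z. x (fst z) * cnj (x (snd z)) * iexp (\<tau> * (fst z - snd z)))" (is "integrable _ ?h")
    and "complex_of_real ((cmod (F x \<tau>))\<^sup>2)
      = (LINT z|(M \<Otimes>\<^sub>M M). x (fst z) * cnj (x (snd z)) * iexp (\<tau> * (fst z - snd z))) / (2 * pi)"
proof -
  interpret P: pair_sigma_finite M M by unfold_locales
  have [measurable]: "x \<in> borel_measurable M" by (rule L2_measurable[OF x])
  have [measurable]: "cnj \<in> borel_measurable borel"
    by (intro borel_measurable_continuous_onI continuous_intros)
  have xi: "integrable M x" by (rule L2_integrable[OF finite_measure_axioms x])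
  have e_meas [measurable]: "(\<lambda>\<xi>. iexp (\<tau> * \<xi>)) \<in> borel_measurable M"
    by (intro continuous_measurable_M continuous_intros)
  define a where "a \<xi> = iexp (\<tau> * \<xi>) * x \<xi>" for \<xi>
  have am [measurable]: "a \<in> borel_measurable M" unfolding a_def[abs_def] by measurable
  have norm_a: "cmod (a \<xi>) = cmod (x \<xi>)" for \<xi> by (simp add: a_def norm_mult)
  have ai: "integrable M a"
    by (rule Bochner_Integration.integrable_bound[OF xi am]) (simp add: norm_a)
  have h_eq: "?h z = a (fst z) * cnj (a (snd z))" for z
    by (simp add: a_def exp_cnj right_diff_distrib exp_diff exp_minus field_simps)
  have int: "integrable (M \<Otimes>\<^sub>M M) (\<lambda>z. a (fst z) * cnj (a (snd z)))"
  proof (rule P.Fubini_integrable)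
    show "(\<lambda>z. a (fst z) * cnj (a (snd z))) \<in> borel_measurable (M \<Otimes>\<^sub>M M)" by measurable
    show "integrable M (\<lambda>\<xi>. LINT \<eta>|M. norm (a (fst (\<xi>, \<eta>)) * cnj (a (snd (\<xi>, \<eta>)))))"
      using ai by (simp add: norm_mult integrable_norm)
    show "AE \<xi> in M. integrable M (\<lambda>\<eta>. a (fst (\<xi>, \<eta>)) * cnj (a (snd (\<xi>, \<eta>))))"
      using ai by simp
  qed
  show "integrable (M \<Otimes>\<^sub>M M) ?h" using int by (simp only: h_eq)
  have "(LINT z|(M \<Otimes>\<^sub>M M). ?h z) = (LINT \<xi>|M. LINT \<eta>|M. a \<xi> * cnj (a \<eta>))"
    unfolding h_eq using P.integral_fst'[OF int] by simp
  also have "\<dots> = (LINT \<xi>|M. a \<xi>) * cnj (LINT \<xi>|M. a \<xi>)" by simp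
  finally have h_prod: "(LINT z|(M \<Otimes>\<^sub>M M). ?h z) = (LINT \<xi>|M. a \<xi>) * cnj (LINT \<xi>|M. a \<xi>)" .
  have F_eq: "F x \<tau> = (LINT \<xi>|M. a \<xi>) / sqrt (2 * pi)"
    by (simp add: truncated_fourier_def a_def mult.assoc)
  have "complex_of_real ((cmod (F x \<tau>))\<^sup>2) = F x \<tau> * cnj (F x \<tau>)" by (rule complex_norm_square)
  also have "\<dots> = (LINT \<xi>|M. a \<xi>) * cnj (LINT \<xi>|M. a \<xi>)
      / (complex_of_real (sqrt (2 * pi)) * complex_of_real (sqrt (2 * pi)))"
    by (simp only: F_eq complex_cnj_divide complex_cnj_complex_of_real times_divide_times_eq)
  also have "complex_of_real (sqrt (2 * pi)) * complex_of_real (sqrt (2 * pi)) = 2 * pi"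
    by (simp flip: of_real_mult)
  finally show "complex_of_real ((cmod (F x \<tau>))\<^sup>2) = (LINT z|(M \<Otimes>\<^sub>M M). ?h z) / (2 * pi)"
    using h_prod by simp
qed

text \<open>Fubini replaces the character by the characteristic function of the standard normal
  distribution, which is the Gaussian kernel of \<open>gaussian_form_le\<close>. The constant is
  \<open>sqrt (2 * pi) / \<sigma>\<close> from that lemma divided by \<open>2 * pi\<close>.\<close>

lemma F_gaussian_mean_le:
  assumes x: "x \<in> L2 M" and \<sigma>: "\<sigma> > 0"
  shows "(LINT t|std_normal_distribution. (cmod (F x (\<sigma> * t)))\<^sup>2) \<le> (L2_norm M x)\<^sup>2 / (\<sigma> * sqrt (2 * pi))"
proof -
  interpret P: pair_sigma_finite M M by unfold_locales
  interpret PP: finite_measure "M \<Otimes>\<^sub>M M"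
    by (intro finite_measure_pair_measure finite_measure_axioms)
  interpret N: prob_space std_normal_distribution
    by (rule real_distribution.axioms(1)[OF real_dist_normal_dist])
  interpret Q: pair_sigma_finite std_normal_distribution "M \<Otimes>\<^sub>M M" by unfold_locales
  have [measurable]: "x \<in> borel_measurable M" by (rule L2_measurable[OF x])
  have [measurable]: "cnj \<in> borel_measurable borel"
    by (intro borel_measurable_continuous_onI continuous_intros)
  define G where "G z = x (fst z) * cnj (x (snd z))" for z
  define D where "D z = fst z - snd z" for z :: "real \<times> real"
  have [measurable]: "G \<in> borel_measurable (M \<Otimes>\<^sub>M M)" unfolding G_def[abs_def] by measurable
  have [measurable]: "D \<in> borel_measurable (M \<Otimes>\<^sub>M M)" unfolding D_def[abs_def] by (rule difference_measurable)
  have F_eq: "integrable (M \<Otimes>\<^sub>M M) (\<lambda>z. G z * iexp (\<tau> * D z))"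
    "complex_of_real ((cmod (F x \<tau>))\<^sup>2) = (LINT z|(M \<Otimes>\<^sub>M M). G z * iexp (\<tau> * D z)) / (2 * pi)" for \<tau>
    unfolding G_def D_def by (rule F_norm_sq_eq[OF x])+
  have G: "integrable (M \<Otimes>\<^sub>M M) G" using F_eq(1)[of 0] by simp
  define h where "h t z = G z * iexp (\<sigma> * t * D z)" for t z
  have norm_h: "norm (h t z) = norm (G z)" for t z by (simp add: h_def norm_mult)
  have hm [measurable]: "(\<lambda>(t, z). h t z) \<in> borel_measurable (std_normal_distribution \<Otimes>\<^sub>M (M \<Otimes>\<^sub>M M))"
    unfolding h_def by measurable
  have h_int: "integrable (std_normal_distribution \<Otimes>\<^sub>M (M \<Otimes>\<^sub>M M)) (\<lambda>(t, z). h t z)"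
    using F_eq(1)[of "\<sigma> * _"] by (intro Q.Fubini_integrable hm) (simp_all add: norm_h, simp add: h_def)
  have g_char: "(LINT t|std_normal_distribution. h t z) = G z * exp (- (\<sigma> * D z)\<^sup>2 / 2)" for z
  proof -
    have "(LINT t|std_normal_distribution. h t z) = G z * char std_normal_distribution (\<sigma> * D z)"
      unfolding h_def char_def by (simp add: mult_ac)
    then show ?thesis by (simp add: char_std_normal_distribution)
  qed
  have bound: "(LINT z|(M \<Otimes>\<^sub>M M). norm (G z) * exp (- (\<sigma> * D z)\<^sup>2 / 2)) \<le> sqrt (2 * pi) / \<sigma> * (L2_norm M x)\<^sup>2"
  proof -
    have "(LINT z|(M \<Otimes>\<^sub>M M). norm (G z) * exp (- (\<sigma> * D z)\<^sup>2 / 2))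
        = enn2real (\<integral>\<^sup>+ z. ennreal (norm (G z) * exp (- (\<sigma> * D z)\<^sup>2 / 2)) \<partial>(M \<Otimes>\<^sub>M M))"
      by (rule integral_eq_nn_integral) auto
    also have "\<dots> \<le> enn2real (ennreal (sqrt (2 * pi) / \<sigma> * (L2_norm M x)\<^sup>2))"
      using gaussian_form_le[OF x \<sigma>] by (intro enn2real_mono) (simp_all add: G_def D_def norm_mult)
    also have "\<dots> = sqrt (2 * pi) / \<sigma> * (L2_norm M x)\<^sup>2" using \<sigma> by simp
    finally show ?thesis .
  qed
  have "complex_of_real (LINT t|std_normal_distribution. (cmod (F x (\<sigma> * t)))\<^sup>2)
      = (LINT t|std_normal_distribution. (LINT z|(M \<Otimes>\<^sub>M M). h t z)) / (2 * pi)"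
    by (simp only: integral_complex_of_real[symmetric] F_eq(2) h_def) simp
  also have "(LINT t|std_normal_distribution. (LINT z|(M \<Otimes>\<^sub>M M). h t z))
      = (LINT z|(M \<Otimes>\<^sub>M M). (LINT t|std_normal_distribution. h t z))"
    using Q.Fubini_integral[OF h_int] by simp
  also have "\<dots> = (LINT z|(M \<Otimes>\<^sub>M M). G z * exp (- (\<sigma> * D z)\<^sup>2 / 2))" by (simp only: g_char)
  finally have eq: "complex_of_real (LINT t|std_normal_distribution. (cmod (F x (\<sigma> * t)))\<^sup>2)
      = (LINT z|(M \<Otimes>\<^sub>M M). G z * exp (- (\<sigma> * D z)\<^sup>2 / 2)) / (2 * pi)" .
  \<comment> \<open>The mean is a nonnegative real, so taking moduli in \<open>eq\<close> leaves it
    unchanged and allows the triangle inequality on the right.\<close>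
  have "(LINT t|std_normal_distribution. (cmod (F x (\<sigma> * t)))\<^sup>2)
      = cmod (LINT z|(M \<Otimes>\<^sub>M M). G z * exp (- (\<sigma> * D z)\<^sup>2 / 2)) / (2 * pi)"
    using arg_cong[OF eq, of cmod] by (simp add: norm_divide)
  also have "\<dots> \<le> (LINT z|(M \<Otimes>\<^sub>M M). norm (G z) * exp (- (\<sigma> * D z)\<^sup>2 / 2)) / (2 * pi)"
    using integral_norm_bound[of "M \<Otimes>\<^sub>M M" "\<lambda>z. G z * exp (- (\<sigma> * D z)\<^sup>2 / 2)"]
    by (intro divide_right_mono) (simp_all add: norm_mult)
  also have "\<dots> \<le> (sqrt (2 * pi) / \<sigma> * (L2_norm M x)\<^sup>2) / (2 * pi)"
    by (intro divide_right_mono bound) simp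
  also have "\<dots> = (L2_norm M x)\<^sup>2 / (\<sigma> * sqrt (2 * pi))"
  proof -
    have "s / \<sigma> * n / (s * s) = n / (\<sigma> * s)" if "s \<noteq> 0" for s n
      using that \<sigma> by (simp add: field_simps)
    from this[of "sqrt (2 * pi)" "(L2_norm M x)\<^sup>2"] show ?thesis by simp
  qed
  finally show ?thesis .
qed

text \<open>Substituting \<open>\<sigma> * t\<close> and inserting the normal density costs the
  factor \<open>\<sigma> * sqrt (2 * pi)\<close>, exactly the denominator of the Gaussian mean, so
  the bound is free of \<open>\<sigma>\<close>.\<close>

lemma F_weighted_le:
  assumes x: "x \<in> L2 M" and \<sigma>: "\<sigma> > 0"
  shows "(\<integral>\<^sup>+ t. ennreal (exp (- (t / \<sigma>)\<^sup>2 / 2) * (cmod (F x t))\<^sup>2) \<partial>lborel) \<le> ennreal ((L2_norm M x)\<^sup>2)"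
proof -
  interpret N: prob_space std_normal_distribution
    by (rule real_distribution.axioms(1)[OF real_dist_normal_dist])
  have [measurable]: "F x \<in> borel_measurable borel"
    by (intro borel_measurable_continuous_onI F_continuous x)
  let ?f = "\<lambda>t. (cmod (F x (\<sigma> * t)))\<^sup>2"
  have int: "integrable std_normal_distribution ?f"
  proof (rule N.integrable_const_bound)
    show "AE t in std_normal_distribution. norm (?f t) \<le> (sqrt (m / (2 * pi)) * L2_norm M x)\<^sup>2"
      using F_bound[OF x] by (intro AE_I2) (simp add: power_mono)
  qed measurable
  have "(\<integral>\<^sup>+ t. ennreal (exp (- (t / \<sigma>)\<^sup>2 / 2) * (cmod (F x t))\<^sup>2) \<partial>lborel)
      = ennreal \<sigma> * (\<integral>\<^sup>+ t. ennreal (exp (- t\<^sup>2 / 2) * ?f t) \<partial>lborel)"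
    using \<sigma> nn_integral_real_affine[of "\<lambda>t. ennreal (exp (- (t / \<sigma>)\<^sup>2 / 2) * (cmod (F x t))\<^sup>2)" \<sigma> 0] by simp
  also have "(\<integral>\<^sup>+ t. ennreal (exp (- t\<^sup>2 / 2) * ?f t) \<partial>lborel)
      = (\<integral>\<^sup>+ t. ennreal (sqrt (2 * pi)) * (ennreal (std_normal_density t) * ennreal (?f t)) \<partial>lborel)"
    by (intro nn_integral_cong) (simp add: std_normal_density_def ennreal_mult'[symmetric])
  also have "\<dots> = ennreal (sqrt (2 * pi)) * (\<integral>\<^sup>+ t. ennreal (?f t) \<partial>std_normal_distribution)"
    by (simp add: nn_integral_cmult nn_integral_density)
  also have "(\<integral>\<^sup>+ t. ennreal (?f t) \<partial>std_normal_distribution) = ennreal (LINT t|std_normal_distribution. ?f t)"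
    by (rule nn_integral_eq_integral[OF int]) simp
  also have "ennreal \<sigma> * (ennreal (sqrt (2 * pi)) * \<dots>)
      = ennreal (\<sigma> * sqrt (2 * pi) * (LINT t|std_normal_distribution. ?f t))"
    using \<sigma> by (simp add: ennreal_mult'[symmetric] mult.assoc)
  also have "\<dots> \<le> ennreal ((L2_norm M x)\<^sup>2)"
    using F_gaussian_mean_le[OF x \<sigma>] \<sigma> by (intro ennreal_leI) (simp add: field_simps)
  finally show ?thesis .
qed

text \<open>For \<open>\<sigma> = n + 1\<close> the weight tends to 1 pointwise, and Fatou's lemma
  bounds the integral over the whole line, which dominates the one over \<open>E\<close>.\<close>

lemma F_contraction:
  assumes x: "x \<in> L2 M"
  shows "L2_norm M (F x) \<le> L2_norm M x"
proof -
  have [measurable]: "F x \<in> borel_measurable borel"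
    by (intro borel_measurable_continuous_onI F_continuous x)
  let ?w = "\<lambda>n t. ennreal (exp (- (t / real (Suc n))\<^sup>2 / 2) * (cmod (F x t))\<^sup>2)"
  have "(\<integral>\<^sup>+ t. ennreal ((cmod (F x t))\<^sup>2) \<partial>M) \<le> (\<integral>\<^sup>+ t. ennreal ((cmod (F x t))\<^sup>2) \<partial>lborel)"
    by (rule nn_integral_M_le) measurable
  also have "\<dots> = (\<integral>\<^sup>+ t. liminf (\<lambda>n. ?w n t) \<partial>lborel)"
  proof (rule nn_integral_cong)
    fix t
    have "(\<lambda>n. t * (1 / real (Suc n))) \<longlonglongrightarrow> t * 0"
      using LIMSEQ_Suc[OF lim_1_over_n] by (intro tendsto_mult tendsto_const) simp
    then have "(\<lambda>n. t / real (Suc n)) \<longlonglongrightarrow> 0" by simp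
    then have "(\<lambda>n. ?w n t) \<longlonglongrightarrow> ennreal (exp (- 0\<^sup>2 / 2) * (cmod (F x t))\<^sup>2)"
      by (intro tendsto_intros) auto
    then show "ennreal ((cmod (F x t))\<^sup>2) = liminf (\<lambda>n. ?w n t)"
      by (intro lim_imp_Liminf[symmetric]) auto
  qed
  also have "\<dots> \<le> liminf (\<lambda>n. \<integral>\<^sup>+ t. ?w n t \<partial>lborel)"
    by (rule nn_integral_liminf) measurable
  also have "\<dots> \<le> liminf (\<lambda>n::nat. ennreal ((L2_norm M x)\<^sup>2))"
    by (intro Liminf_mono always_eventually allI F_weighted_le x) simp
  also have "\<dots> = ennreal ((L2_norm M x)\<^sup>2)" by (intro lim_imp_Liminf) auto
  finally have "(L2_norm M (F x))\<^sup>2 \<le> (L2_norm M x)\<^sup>2"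
    using L2_nn_integral_sq[OF F_L2[OF x]] by simp
  then show ?thesis by (rule power2_le_imp_le) (rule L2_norm_nonneg)
qed

text \<open>The exponentials of \<open>F\<close> and of its adjoint multiply to
  \<open>exp (\<i> * \<xi> * (s - t))\<close>, which explains the swapped arguments of
  \<open>fourier_kernel\<close>; the two normalizations give \<open>2 * pi\<close>. Exchanging the
  integrals is allowed because the modulus of the integrand is that of \<open>f s\<close> on a
  finite measure space.\<close>

lemma adj_F_kernel:
  assumes f: "f \<in> L2 M"
  shows "integrable M (\<lambda>s. fourier_kernel E s t / (2 * pi) * f s)" (is ?integrable)
    and "truncated_fourier_adj E (F f) t = (LINT s|M. fourier_kernel E s t / (2 * pi) * f s)" (is ?eq)
proof -
  interpret P: pair_sigma_finite M M by unfold_locales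
  have [measurable]: "f \<in> borel_measurable M" by (rule L2_measurable[OF f])
  have fi: "integrable M f" by (rule L2_integrable[OF finite_measure_axioms f])
  have id: "complex_of_real \<in> borel_measurable M"
    by (intro continuous_measurable_M continuous_intros)
  have fst_M: "(\<lambda>z. complex_of_real (fst z)) \<in> borel_measurable (M \<Otimes>\<^sub>M M)"
    and snd_M: "(\<lambda>z. complex_of_real (snd z)) \<in> borel_measurable (M \<Otimes>\<^sub>M M)"
    by (rule measurable_compose[OF measurable_fst id], rule measurable_compose[OF measurable_snd id])
  define h where "h \<xi> s = exp (\<i> * \<xi> * (s - t)) * f s" for \<xi> s :: real
  have h_norm: "cmod (h \<xi> s) = cmod (f s)" for \<xi> s by (simp add: h_def norm_mult)
  have hm: "(\<lambda>(\<xi>, s). h \<xi> s) \<in> borel_measurable (M \<Otimes>\<^sub>M M)"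
    unfolding h_def case_prod_beta of_real_diff
    by (intro borel_measurable_times measurable_compose[OF _ borel_measurable_exp] borel_measurable_const
        borel_measurable_diff fst_M snd_M measurable_compose[OF measurable_snd L2_measurable[OF f]])
  have h_meas: "h \<xi> \<in> borel_measurable M" for \<xi>
  proof -
    have "(\<lambda>s. exp (\<i> * \<xi> * (s - t))) \<in> borel_measurable M"
      by (intro continuous_measurable_M continuous_intros)
    then show ?thesis unfolding h_def[abs_def] by measurable
  qed
  have h_int: "integrable M (h \<xi>)" for \<xi>
    by (rule Bochner_Integration.integrable_bound[OF fi h_meas]) (simp add: h_norm)
  have int: "integrable (M \<Otimes>\<^sub>M M) (\<lambda>(\<xi>, s). h \<xi> s)"
    using h_int by (intro P.Fubini_integrable hm) (simp_all add: h_norm)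
  have K: "(LINT \<xi>|M. h \<xi> s) = fourier_kernel E s t * f s" for s
    by (simp add: h_def fourier_kernel_def)
  have "integrable M (\<lambda>s. (LINT \<xi>|M. h \<xi> s) / (2 * pi))"
    by (intro Bochner_Integration.integrable_divide) (rule P.integrable_snd[OF int])
  then show ?integrable by (simp add: K)
  have sq: "complex_of_real (sqrt (2 * pi)) * complex_of_real (sqrt (2 * pi)) = 2 * pi"
    by (simp flip: of_real_mult)
  have "exp (- (\<i> * t * \<xi>)) * F f \<xi> = 1 / sqrt (2 * pi) * (LINT s|M. h \<xi> s)" for \<xi>
  proof -
    have "exp (- (\<i> * t * \<xi>)) * (LINT s|M. exp (\<i> * \<xi> * s) * f s) = (LINT s|M. h \<xi> s)"
      unfolding h_def
    proof (subst integral_mult_right_zero[symmetric], rule Bochner_Integration.integral_cong[OF refl])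
      fix s
      have "exp (\<i> * \<xi> * (s - t)) = exp (- (\<i> * t * \<xi>)) * exp (\<i> * \<xi> * s)"
        by (simp only: exp_add[symmetric]) (simp add: algebra_simps)
      then show "exp (- (\<i> * t * \<xi>)) * (exp (\<i> * \<xi> * s) * f s) = exp (\<i> * \<xi> * (s - t)) * f s"
        by (simp only: mult.assoc)
    qed
    then show ?thesis unfolding truncated_fourier_def by (simp add: mult.left_commute)
  qed
  then have "truncated_fourier_adj E (F f) t = 1 / sqrt (2 * pi) * (1 / sqrt (2 * pi) * (LINT \<xi>|M. (LINT s|M. h \<xi> s)))"
    unfolding truncated_fourier_adj_def by simp
  also have "\<dots> = (LINT \<xi>|M. (LINT s|M. h \<xi> s)) / (2 * pi)"
    using sq by simp
  also have "(LINT \<xi>|M. (LINT s|M. h \<xi> s)) = (LINT s|M. (LINT \<xi>|M. h \<xi> s))"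
    by (rule P.Fubini_integral[OF int, symmetric])
  also have "\<dots> / (2 * pi) = (LINT s|M. fourier_kernel E s t / (2 * pi) * f s)"
    by (simp add: K)
  finally show ?eq .
qed

end

theorem theorem1p5:
  fixes E :: "real set"
  assumes "E \<in> sets lebesgue"
    and "emeasure lebesgue E > 0"
    and "emeasure lebesgue E < \<infinity>"
  shows
    "L2_integral_operator (lebesgue_on E)
       (\<lambda>x. truncated_fourier_adj E (truncated_fourier E x))
       (\<lambda>t s. fourier_kernel E s t / (2 * pi))
     \<and> L2_trace_class (lebesgue_on E) (\<lambda>x. truncated_fourier_adj E (truncated_fourier E x))
     \<and> L2_trace (lebesgue_on E) (\<lambda>x. truncated_fourier_adj E (truncated_fourier E x))
         = complex_of_real ((measure lebesgue E)\<^sup>2 / (2 * pi))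
     \<and> L2_hilbert_schmidt (lebesgue_on E) (truncated_fourier E)
     \<and> L2_hs_norm (lebesgue_on E) (truncated_fourier E) = measure lebesgue E / sqrt (2 * pi)
     \<and> L2_compact (lebesgue_on E) (truncated_fourier E)
     \<and> ennreal ((measure lebesgue E)\<^sup>2 / (2 * pi))
         \<le> L2_trace_norm (lebesgue_on E) (truncated_fourier E)
     \<and> L2_trace_norm (lebesgue_on E) (truncated_fourier E) \<le> \<infinity>"
proof -
  interpret finite_lebesgue_set E using assms by unfold_locales
  let ?A = "\<lambda>x. truncated_fourier_adj E (F x)"
  let ?c = "m\<^sup>2 / (2 * pi)"
  \<comment> \<open>Trace and Hilbert-Schmidt norm are written in this chosen basis, to which the
    sum formula for arbitrary bases applies.\<close>
  define V where "V = L2_basis M"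
  have onb: "L2_onb M V"
    unfolding V_def L2_basis_def by (rule someI_ex[OF L2_onb_exists])
  have sum: "((\<lambda>e. (L2_norm M (F e))\<^sup>2) has_sum ?c) V" by (rule has_sum_norm_F_sq[OF onb])
  have A_compact: "L2_compact M ?A" by (rule gram_operator_compact[OF F_compact FF_operator])
  have "L2_integral_operator M ?A (\<lambda>t s. fourier_kernel E s t / (2 * pi))"
    unfolding L2_integral_operator_def using adj_F_kernel by blast
  moreover have "L2_trace_class M ?A"
    unfolding L2_trace_class_def
    using A_compact gram_operator_trace_norm_le[OF A_compact sum_norm_F_sq_le]
    by (auto intro: le_less_trans)
  moreover have "L2_trace M ?A = complex_of_real ?c"
  proof -
    have "L2_inner M (?A e) e = complex_of_real ((L2_norm M (F e))\<^sup>2)" if "e \<in> V" for e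
      using L2_orthonormalD(1)[of M V e] onb that
      by (simp add: L2_onb_def inner_ST_left L2_inner_self)
    then have "L2_trace M ?A = (\<Sum>\<^sub>\<infinity>e\<in>V. complex_of_real ((L2_norm M (F e))\<^sup>2))"
      unfolding L2_trace_def V_def[symmetric] by (rule infsum_cong)
    also have "\<dots> = complex_of_real ?c"
      by (rule infsumI[OF has_sum_of_real[OF sum]])
    finally show ?thesis .
  qed
  moreover have "L2_hilbert_schmidt M F"
    unfolding L2_hilbert_schmidt_def V_def[symmetric]
    using F_operator sum by (auto simp: summable_on_def)
  moreover have "L2_hs_norm M F = m / sqrt (2 * pi)"
    unfolding L2_hs_norm_def V_def[symmetric] infsumI[OF sum] by (simp add: real_sqrt_divide)
  moreover have "ennreal ?c \<le> L2_trace_norm M F"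
  proof -
    \<comment> \<open>\<open>W\<close> extends the singular vectors and in general differs from
      \<open>V\<close>; the sum of squared norms has the same value over both.\<close>
    obtain W where W: "L2_onb M W"
      and le: "\<And>G. finite G \<Longrightarrow> G \<subseteq> W \<Longrightarrow> ennreal (\<Sum>e\<in>G. (L2_norm M (F e))\<^sup>2) \<le> L2_trace_norm M F"
      using sum_norm_sq_le_trace_norm[OF F_compact F_contraction sum_norm_F_sq_le] by blast
    have sumW: "((\<lambda>e. (L2_norm M (F e))\<^sup>2) has_sum ?c) W" by (rule has_sum_norm_F_sq[OF W])
    have "ennreal (\<Sum>\<^sub>\<infinity>e\<in>W. (L2_norm M (F e))\<^sup>2)
        = (SUP G\<in>{G. finite G \<and> G \<subseteq> W}. ennreal (\<Sum>e\<in>G. (L2_norm M (F e))\<^sup>2))"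
      using sumW by (intro infsum_nonneg_is_SUPREMUM_ennreal) (auto simp: summable_on_def)
    also have "\<dots> \<le> L2_trace_norm M F" using le by (intro SUP_least) auto
    finally show ?thesis by (simp add: infsumI[OF sumW])
  qed
  ultimately show ?thesis using F_compact by simp
qed

end
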